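(* Let $p$ be a prime with $p \equiv 1 \pmod{3}$, let $q = p^s$, let $m$ be a positive integer, let $Q = (q^m-1)/(q-1)$, let $N \mid q^m-1$ be such that $\gcd(N,Q) = 3^n$ for some $n \geq 1$, and let $K_Q$ be the largest divisor of $N$ with $3 \nmid K_Q$. Let $c \in \mathbb{Z}$ with $c \equiv 1 \pmod{3}$ and $p \nmid c$ be a solution to the equation $4q^{m/3} = c^2 + 27d^2$ with $d \in \mathbb{Z}$. Then $$Z_{q,m,N}(0) = \frac{(q-1)\phi(K_Q)}{qK_Q} \left( \frac{2Q - 2 - cq^{m/3}}{3} \right).$$
   Context: $\phi$ is Euler's function and divisors are positive. For a positive divisor $N$ of $q^m-1$, a non-zero element $\xi \in \mathbb{F}_{q^m}^*$ is called $N$-free if, for any $d \mid N$, $\xi = \gamma^d$ with $\gamma \in \mathbb{F}_{q^m}$ implies $d=1$; equivalently $\xi = \alpha^k$ for some integer $k$ coprime to $N$, where $\alpha$ is a primitive element of $\mathbb{F}_{q^m}$. For $a \in \mathbb{F}_q$, $Z_{q,m,N}(a)$ denotes the number of $N$-free elements $\xi \in \mathbb{F}_{q^m}^*$ with $\operatorname{Tr}_{\mathbb{F}_{q^m}/\mathbb{F}_q}(\xi) = a$. *)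

theory Defs
  imports Complex_Main "HOL-Number_Theory.Number_Theory"
begin

(* The field is a type 'a of class {field, finite} with q^m elements.  The
   subfield with q elements is then {x. x^q = x}, and the extension is Galois with cyclic group
   generated by x |-> x^q, so the trace is the sum of the conjugates x^(q^i).  The trace takes
   values in the subfield, embedded in 'a. *)

definition field_trace :: "nat \<Rightarrow> nat \<Rightarrow> 'a::{field,finite} \<Rightarrow> 'a" where
  "field_trace q m x = (\<Sum>i<m. x ^ (q ^ i))"

definition N_free :: "nat \<Rightarrow> 'a::{field,finite} \<Rightarrow> bool" where
  "N_free N \<xi> \<longleftrightarrow> \<xi> \<noteq> 0 \<and> (\<forall>d. d dvd N \<longrightarrow> (\<exists>\<gamma>. \<xi> = \<gamma> ^ d) \<longrightarrow> d = 1)"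

definition Z :: "nat \<Rightarrow> nat \<Rightarrow> nat \<Rightarrow> 'a::{field,finite} \<Rightarrow> nat" where
  "Z q m N a = card {\<xi>. N_free N \<xi> \<and> field_trace q m \<xi> = a}"

end

theory Submission
  imports Defs "HOL-Computational_Algebra.Polynomial"
begin

text \<open>
  Write \<open>F\<close> for the field with \<open>q ^ m\<close> elements, \<open>Tr\<close> for the trace to its subfield with \<open>q\<close>
  elements and \<open>g\<close> for a primitive element. Since \<open>q \<equiv> 1 (mod 3)\<close> and \<open>3\<close> divides \<open>Q\<close>, the degree
  \<open>m = 3 t\<close> is a multiple of \<open>3\<close>; put \<open>r = q ^ t\<close>, so that \<open>F\<close> has \<open>r\<^sup>3\<close> elements.

  Reduction to non-cubes. The element \<open>g ^ k\<close> is \<open>N\<close>-free iff \<open>k\<close> is coprime to \<open>N\<close>, that is, iff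
  \<open>3\<close> does not divide \<open>k\<close> and \<open>k\<close> is coprime to \<open>K\<close>. Vanishing of the trace depends only on
  \<open>k mod Q\<close>, because \<open>g ^ Q\<close> generates the non-zero elements of the subfield, and so does
  divisibility of \<open>k\<close> by \<open>3\<close>. As \<open>K\<close> is coprime to \<open>Q\<close> and divides \<open>q - 1\<close>, the Chinese remainder
  theorem makes the remaining condition independent of these two, and it holds with frequency
  \<open>totient K / K\<close>. So it suffices to count the non-cubes of trace zero (\<open>Z_noncubes\<close>).

  Counting non-cubes. Let \<open>\<psi>\<close> be a non-trivial additive character of \<open>F\<close> that is trivial on the
  kernel of \<open>Tr\<close>, and \<open>S(b) = \<Sum>x. \<psi> (b x\<^sup>3)\<close>. Every element of the subfield is a cube in \<open>F\<close>, so
  summing over the subfield expresses the number of \<open>x\<close> with \<open>Tr (x\<^sup>3) = 0\<close> through \<open>S(1)\<close>. The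
  claim becomes \<open>S(1) = r c\<close> with the \<open>c\<close> of the theorem.

  The value of \<open>S(1)\<close>. The first three moments of \<open>S\<close> count solutions of
  \<open>x\<^sup>3 = 0\<close>, \<open>x\<^sup>3 + y\<^sup>3 = 0\<close> and \<open>x\<^sup>3 + y\<^sup>3 + z\<^sup>3 = 0\<close>. They show that \<open>S(1)\<close>, \<open>S(g)\<close>, \<open>S(g\<^sup>2)\<close> are
  the roots of \<open>X\<^sup>3 - 3 r\<^sup>3 X - r\<^sup>3 T\<close>, where \<open>T\<close> is determined by the number of points of
  \<open>x\<^sup>3 + y\<^sup>3 = 1\<close> (\<open>cubic_sum_relations\<close>). All three are integers. Two pieces of arithmetic pin
  down \<open>S(1)\<close>. First, modulo \<open>p\<close> the number \<open>T\<close> is a central binomial coefficient up to sign and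
  hence not divisible by \<open>p\<close> (\<open>jacobi_trace_not_dvd\<close>); the cubic equation then forces
  \<open>S(1) = r c'\<close> with \<open>c'\<close> prime to \<open>p\<close>. Second, the map \<open>u \<mapsto> u ^ r\<close> has order three, preserves
  traces and fixes no non-cube, so \<open>S(g)\<close> and \<open>S(g\<^sup>2)\<close> are \<open>1\<close> modulo \<open>9\<close>
  (\<open>noncube_class_dvd_9\<close>); with the discriminant of the cubic this yields
  \<open>4 r = c'\<^sup>2 + 27 d'\<^sup>2\<close> and \<open>c' \<equiv> 1 (mod 3)\<close>. These conditions determine \<open>c'\<close>
  (\<open>representation_unique\<close>), so \<open>c' = c\<close>.
\<close>

section \<open>Central binomial coefficients modulo a prime\<close>

text \<open>
  The multiples of \<open>p\<close> among the factors \<open>1, \<dots>, p A + B\<close> contribute \<open>p ^ A * fact A\<close>; the cofactor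
  \<open>u\<close> collects the factors prime to \<open>p\<close>.
\<close>
lemma fact_block:
  fixes p A B :: nat
  assumes "prime p" "B < p"
  shows "\<exists>u. fact (p * A + B) = p ^ A * fact A * u \<and> \<not> p dvd u"
proof -
  have block: "\<exists>u. fact (p * A + B) = p ^ A * fact A * u \<and> \<not> p dvd u"
    if "\<exists>u. fact (p * A) = p ^ A * fact A * u \<and> \<not> p dvd u" "B < p" for A B
    using that(2)
  proof (induction B)
    case 0
    then show ?case using that(1) by simp
  next
    case (Suc B)
    then obtain u where u: "fact (p * A + B) = p ^ A * fact A * u" "\<not> p dvd u"
      by auto
    have "\<not> p dvd Suc (p * A + B)"
    proof
      assume "p dvd Suc (p * A + B)"
      then have "p dvd Suc B"
        by (metis add_Suc_right dvd_add_right_iff dvd_triv_left)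
      then show False using Suc.prems by (simp add: nat_dvd_not_less)
    qed
    then have "\<not> p dvd u * Suc (p * A + B)"
      using u(2) assms(1) prime_dvd_mult_iff by blast
    moreover have "fact (p * A + Suc B) = Suc (p * A + B) * (fact (p * A + B) :: nat)"
      by simp
    ultimately show ?case
      using u(1) by (intro exI[of _ "u * Suc (p * A + B)"]) (simp del: mult_Suc mult_Suc_right)
  qed
  have "\<exists>u. fact (p * A) = p ^ A * fact A * u \<and> \<not> p dvd u"
  proof (induction A)
    case 0
    then show ?case using assms(1) by (auto simp: not_prime_unit)
  next
    case (Suc A)
    have "p - 1 < p" using assms(1) prime_gt_0_nat by simp
    then obtain u where u: "fact (p * A + (p - 1)) = p ^ A * fact A * u" "\<not> p dvd u"
      using block[OF Suc] by blast
    have "p * Suc A = Suc (p * A + (p - 1))"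
      using assms(1) prime_gt_0_nat[of p] by simp
    then have "fact (p * Suc A) = (p * Suc A) * fact (p * A + (p - 1))"
      by (metis fact_Suc of_nat_id)
    then show ?case
      using u by (intro exI[of _ u]) (simp add: algebra_simps)
  qed
  from block[OF this assms(2)] show ?thesis .
qed

text \<open>
  One digit of Lucas' theorem: since \<open>2 B < p\<close>, doubling \<open>p A + B\<close> produces no carry out of the last
  base-\<open>p\<close> digit, so the powers of \<open>p\<close> in the three factorials cancel and the two central
  binomial coefficients differ by factors prime to \<open>p\<close> only.
\<close>
lemma central_binomial_not_dvd_step:
  fixes p A B :: nat
  assumes p: "prime p" and B: "2 * B < p" and A: "\<not> p dvd (2 * A) choose A"
  shows "\<not> p dvd (2 * (p * A + B)) choose (p * A + B)"
proof -
  define M where "M = p * A + B"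
  obtain u where u: "fact (p * (2 * A) + 2 * B) = p ^ (2 * A) * fact (2 * A) * u" "\<not> p dvd u"
    using fact_block[OF p B] by blast
  have "B < p" using B by simp
  then obtain v where v: "fact (p * A + B) = p ^ A * fact A * v" "\<not> p dvd v"
    using fact_block[OF p] by blast
  have binom: "fact k * fact k * ((2 * k) choose k) = fact (2 * k)" for k :: nat
    using binomial_fact_lemma[of k "2 * k"] by simp
  have "p * (2 * A) + 2 * B = 2 * M" by (simp add: M_def)
  with u(1) have "fact (2 * M) = p ^ (2 * A) * (fact A * fact A * ((2 * A) choose A)) * u"
    unfolding binom[of A] by simp
  then have "(p ^ A * fact A * v) * (p ^ A * fact A * v) * ((2 * M) choose M)
      = p ^ (2 * A) * (fact A * fact A * ((2 * A) choose A)) * u"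
    using binom[of M] v(1) unfolding M_def[symmetric] by simp
  then have "(p ^ A * p ^ A * (fact A * fact A)) * (v * v * ((2 * M) choose M))
      = (p ^ A * p ^ A * (fact A * fact A)) * (((2 * A) choose A) * u)"
    by (simp add: mult_2_right power_add mult_ac)
  then have "v * v * ((2 * M) choose M) = ((2 * A) choose A) * u"
    using p prime_gt_0_nat[of p] by simp
  moreover have "\<not> p dvd ((2 * A) choose A) * u"
    using p A u(2) prime_dvd_mult_iff by blast
  ultimately show ?thesis
    unfolding M_def by (metis dvd_mult)
qed

text \<open>
  All base-\<open>p\<close> digits of \<open>a = (p ^ e - 1) / 3\<close> equal \<open>(p - 1) / 3\<close>, which is less than \<open>p / 2\<close>, so
  adding \<open>a\<close> to itself never carries.
\<close>
lemma central_binomial_third_not_dvd: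
  fixes p a e :: nat
  assumes p: "prime p" "p mod 3 = 1" and a: "3 * a + 1 = p ^ e"
  shows "\<not> p dvd (2 * a) choose a"
  using a
proof (induction e arbitrary: a)
  case 0
  then show ?case using p(1) by (auto simp: not_prime_unit)
next
  case (Suc e)
  define b where "b = p div 3"
  have b: "p = 3 * b + 1" using p(2) unfolding b_def by presburger
  have "p ^ e mod 3 = 1"
    by (metis p(2) power_mod power_one mod_less one_less_numeral_iff semiring_norm(77))
  then obtain a' where a': "3 * a' + 1 = p ^ e"
    by (metis mult_div_mod_eq)
  have "3 * a + 1 = p * (3 * a' + 1)" using Suc.prems a' by simp
  then have "a = p * a' + b" using b by (simp add: algebra_simps)
  moreover have "2 * b < p" using b by simp
  ultimately show ?case
    using central_binomial_not_dvd_step[OF p(1) _ Suc.IH[OF a']] by simp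
qed

section \<open>Arithmetic of the form \<open>c\<^sup>2 + 27 d\<^sup>2\<close>\<close>

text \<open>
  Of the two numbers \<open>c d' \<plusminus> c' d\<close> one is divisible by \<open>p ^ k\<close>, as their product is divisible by it
  and \<open>p\<close> cannot divide both. The composition identity for the form bounds that number so
  sharply that it must be zero.
\<close>
lemma representation_unique:
  fixes p :: nat and c d c' d' :: int
  assumes p: "prime p" "p \<noteq> 2" and k: "k \<ge> 1"
    and rep: "4 * int p ^ k = c\<^sup>2 + 27 * d\<^sup>2" "4 * int p ^ k = c'\<^sup>2 + 27 * d'\<^sup>2"
    and ndvd: "\<not> int p dvd c" "\<not> int p dvd c'"
    and mod: "c mod 3 = 1" "c' mod 3 = 1"
  shows "c = c'"
proof -
  have pI: "prime (int p)" using p(1) by simp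
  define r where "r = int p ^ k"
  have r_pos: "r > 0" using p(1) prime_gt_0_nat[of p] by (simp add: r_def)
  have odd: "\<not> int p dvd 2"
  proof
    assume "int p dvd 2"
    then have "p dvd 2" by (metis int_dvd_int_iff of_nat_numeral)
    then have "p = 2" using p(1) primes_dvd_imp_eq two_is_prime_nat by blast
    with p(2) show False by simp
  qed
  have prod: "(c * d' - c' * d) * (c * d' + c' * d) = 4 * r * (d'\<^sup>2 - d\<^sup>2)"
  proof -
    have "(c * d' - c' * d) * (c * d' + c' * d) = c\<^sup>2 * d'\<^sup>2 - c'\<^sup>2 * d\<^sup>2"
      by (simp add: algebra_simps power2_eq_square)
    also have "c\<^sup>2 = 4 * r - 27 * d\<^sup>2" using rep(1) by (simp add: r_def)
    also have "c'\<^sup>2 = 4 * r - 27 * d'\<^sup>2" using rep(2) by (simp add: r_def)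
    finally show ?thesis by (simp add: algebra_simps)
  qed
  \<comment> \<open>a non-zero multiple of \<open>r\<close> is too large, because \<open>27 > 16\<close>; \<open>e = -d\<close> covers the other sign\<close>
  have zero: "x = 0" if x: "x = c * d' - c' * e" "r dvd x" "e\<^sup>2 = d\<^sup>2" for x e
  proof -
    have "(4 * r) * (4 * r) = (c\<^sup>2 + 27 * e\<^sup>2) * (c'\<^sup>2 + 27 * d'\<^sup>2)"
      using rep x(3) by (simp add: r_def)
    also have "\<dots> = (c * c' + 27 * e * d')\<^sup>2 + 27 * x\<^sup>2"
      unfolding x(1) by (simp add: algebra_simps power2_eq_square)
    finally have le: "27 * x\<^sup>2 \<le> 16 * r\<^sup>2"
      by (simp add: power2_eq_square)
    obtain z where z: "x = r * z" using x(2) by blast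
    have "r\<^sup>2 * (27 * z\<^sup>2) \<le> r\<^sup>2 * 16"
      using le by (simp add: z power_mult_distrib mult_ac)
    then have "27 * z\<^sup>2 \<le> 16" using r_pos by simp
    then have "z\<^sup>2 < 1" by simp
    then have "z = 0" by (metis int_one_le_iff_zero_less not_le zero_less_power2)
    then show ?thesis using z by simp
  qed
  have eq: "c\<^sup>2 * d'\<^sup>2 = c'\<^sup>2 * d\<^sup>2"
  proof (cases "int p dvd c * d' - c' * d \<and> int p dvd c * d' + c' * d")
    case True
    \<comment> \<open>this case is contradictory: \<open>p\<close> would divide \<open>d'\<close> and then \<open>c'\<close>\<close>
    then have "int p dvd (c * d' - c' * d) + (c * d' + c' * d)" by (meson dvd_add)
    then have "int p dvd 2 * (c * d')" by simp
    then have pd': "int p dvd d'" using pI ndvd(1) odd by (simp add: prime_dvd_mult_iff)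
    have "int p dvd 4 * int p ^ k" using k by simp
    moreover have "int p dvd 27 * d'\<^sup>2" using pd' by (simp add: power2_eq_square)
    ultimately have "int p dvd c'\<^sup>2" using rep(2) by (metis dvd_add_left_iff)
    then show ?thesis using ndvd(2) pI prime_dvd_power by blast
  next
    case False
    have rdvd: "r dvd (c * d' - c' * d) * (c * d' + c' * d)" unfolding prod by simp
    have "r dvd c * d' - c' * d \<or> r dvd c * d' + c' * d"
    proof -
      note * = False
      show ?thesis
      proof (cases "int p dvd c * d' - c' * d")
        case True
        with * have "coprime r (c * d' + c' * d)"
          unfolding r_def using pI by (auto intro!: prime_imp_coprime simp: coprime_power_left_iff)
        then show ?thesis using rdvd by (simp add: coprime_dvd_mult_left_iff)
      next
        case False
        then have "coprime r (c * d' - c' * d)"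
          unfolding r_def using pI by (auto intro!: prime_imp_coprime simp: coprime_power_left_iff)
        then show ?thesis using rdvd by (simp add: coprime_dvd_mult_right_iff)
      qed
    qed
    then have "c * d' - c' * d = 0 \<or> c * d' + c' * d = 0"
      using zero[of _ d] zero[of _ "-d"] by auto
    then have "(c * d' - c' * d) * (c * d' + c' * d) = 0" by auto
    then show ?thesis by (simp add: algebra_simps power2_eq_square)
  qed
  have "4 * r * (d'\<^sup>2 - d\<^sup>2) = 0"
    unfolding prod[symmetric] using eq by (simp add: algebra_simps power2_eq_square)
  then have "d'\<^sup>2 = d\<^sup>2" using r_pos by simp
  then have "c\<^sup>2 = c'\<^sup>2" using rep by simp
  then have "c = c' \<or> c = - c'" by (simp add: power2_eq_iff)
  then show ?thesis using mod by presburger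
qed

text \<open>
  The hypotheses make \<open>S\<close>, \<open>S1\<close>, \<open>S2\<close> the roots of \<open>X\<^sup>3 - 3 r\<^sup>3 X - r\<^sup>3 T\<close>. The equation for \<open>S\<close>
  shows that \<open>r\<^sup>3\<close> divides \<open>S\<^sup>3\<close>, and \<open>T\<close> being prime to \<open>p\<close> keeps the cofactor \<open>c = S / r\<close> prime
  to \<open>p\<close>. The discriminant relation, divided by \<open>r\<^sup>2\<close>, gives a form \<open>c\<^sup>2 + 3 y\<^sup>2\<close>, and the
  congruences modulo \<open>9\<close> supply the factor \<open>3\<close> in \<open>y\<close>.
\<close>
lemma cubic_periods_integral:
  fixes p r :: nat and S S1 S2 T :: int
  assumes p: "prime p" "p \<noteq> 3" and r: "r = p ^ k" "k \<ge> 1" "r mod 3 = 1"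
    and cubic: "S ^ 3 = int r ^ 3 * (3 * S + T)"
    and disc: "3 * (4 * int r ^ 3 - S\<^sup>2) = (S1 - S2)\<^sup>2"
    and sum: "S + S1 + S2 = 0"
    and mod9: "S1 mod 9 = 1" "S2 mod 9 = 1"
    and T: "\<not> int p dvd T"
  obtains c d where "S = int r * c" "4 * int r = c\<^sup>2 + 27 * d\<^sup>2" "\<not> int p dvd c" "c mod 3 = 1"
proof -
  have r0: "r > 0" using r p(1) prime_gt_0_nat[of p] by simp
  have pr: "int p dvd int r" using r by simp
  have "int r ^ 3 dvd S ^ 3" unfolding cubic by simp
  then have "int r dvd S" by simp
  then obtain c where c: "S = int r * c" by blast
  have "int r ^ 3 * c ^ 3 = int r ^ 3 * (3 * S + T)"
    using cubic by (simp add: c power_mult_distrib)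
  then have c3: "c ^ 3 = 3 * S + T" using r0 by simp
  have "\<not> int p dvd c"
  proof
    assume "int p dvd c"
    then have "int p dvd c ^ 3" by (simp add: dvd_power_iff power3_eq_cube)
    moreover have "int p dvd 3 * S" using pr c by simp
    ultimately have "int p dvd T" unfolding c3 by (simp add: dvd_add_right_iff)
    with T show False by simp
  qed
  moreover have "c mod 3 = 1"
  proof -
    have "S mod 3 = 1" using sum mod9 by presburger
    moreover have "S mod 3 = (int r mod 3) * (c mod 3) mod 3" unfolding c by (simp add: mod_mult_eq)
    moreover have "int r mod 3 = 1" using r(3) by presburger
    ultimately show ?thesis by simp
  qed
  moreover obtain d where "4 * int r = c\<^sup>2 + 27 * d\<^sup>2"
  proof -
    have "9 dvd S1 - S2" using mod9 by presburger
    then obtain w where w: "S1 - S2 = 9 * w" by blast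
    have "3 * (4 * int r ^ 3 - (int r * c)\<^sup>2) = 81 * w\<^sup>2"
      using disc unfolding w c by (simp add: power_mult_distrib)
    then have eq: "(int r)\<^sup>2 * (4 * int r - c\<^sup>2) = 27 * w\<^sup>2"
      by (simp add: algebra_simps power2_eq_square power3_eq_cube)
    have "prime (3 :: nat)" by simp
    with p have "coprime p 3" by (simp add: primes_coprime)
    then have "coprime (int p) 3" by (metis coprime_int_iff of_nat_numeral)
    then have "coprime ((int r)\<^sup>2) (3 ^ 3)"
      unfolding r(1) of_nat_power coprime_power_left_iff coprime_power_right_iff by simp
    moreover have "(int r)\<^sup>2 dvd 3 ^ 3 * w\<^sup>2" using dvdI[OF eq[symmetric]] by simp
    ultimately have "(int r)\<^sup>2 dvd w\<^sup>2" using coprime_dvd_mult_right_iff by blast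
    then have "int r dvd w" by simp
    then obtain d where "w = int r * d" by blast
    with eq have "(int r)\<^sup>2 * (4 * int r - c\<^sup>2) = (int r)\<^sup>2 * (27 * d\<^sup>2)"
      by (simp add: power_mult_distrib)
    then have "4 * int r - c\<^sup>2 = 27 * d\<^sup>2" using r0 by simp
    then show ?thesis using that by (simp add: algebra_simps)
  qed
  ultimately show ?thesis using that c by blast
qed

section \<open>Counting in residue systems and orbits\<close>

lemma card_mod_product:
  fixes Q L :: nat
  assumes "Q > 0"
  shows "card {k. k < Q * L \<and> P (k mod Q) (k div Q)} = (\<Sum>i | i < Q. card {j. j < L \<and> P i j})"
proof -
  have "bij_betw (\<lambda>k. (k mod Q, k div Q)) {k. k < Q * L \<and> P (k mod Q) (k div Q)}
      (SIGMA i:{i. i < Q}. {j. j < L \<and> P i j})"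
  proof (rule bij_betw_byWitness[where f' = "\<lambda>(i, j). i + Q * j"])
    have "i + Q * j < Q * L" if "i < Q" "j < L" for i j
    proof -
      have "i + Q * j < Q * Suc j" using that by simp
      also have "\<dots> \<le> Q * L" using that by (intro mult_le_mono2) simp
      finally show ?thesis .
    qed
    then show "(\<lambda>(i, j). i + Q * j) ` (SIGMA i:{i. i < Q}. {j. j < L \<and> P i j})
        \<subseteq> {k. k < Q * L \<and> P (k mod Q) (k div Q)}"
      using assms by auto
  qed (use assms in \<open>auto simp: less_mult_imp_div_less mult.commute\<close>)
  then have "card {k. k < Q * L \<and> P (k mod Q) (k div Q)} = card (SIGMA i:{i. i < Q}. {j. j < L \<and> P i j})"
    by (rule bij_betw_same_card)
  also have "\<dots> = (\<Sum>i | i < Q. card {j. j < L \<and> P i j})"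
    by (rule card_SigmaI) auto
  finally show ?thesis .
qed

lemma card_mod_periodic:
  fixes Q L :: nat
  assumes "Q > 0"
  shows "card {k. k < Q * L \<and> A (k mod Q)} = card {i. i < Q \<and> A i} * L"
proof -
  have "card {k. k < Q * L \<and> A (k mod Q)} = (\<Sum>i | i < Q. card {j. j < L \<and> A i})"
    using card_mod_product[OF assms, of L "\<lambda>i j. A i"] .
  also have "\<dots> = (\<Sum>i | i < Q. if A i then L else 0)"
    by (rule sum.cong) auto
  also have "\<dots> = card {i. i < Q \<and> A i} * L"
    by (simp add: sum.If_cases Collect_conj_eq)
  finally show ?thesis .
qed

lemma totient_card_lessThan:
  assumes "K > 0"
  shows "totient K = card {k. k < K \<and> coprime k K}"
proof (cases "K = 1")
  case True
  then show ?thesis by simp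
next
  case False
  have "totatives K = {k. k < K \<and> coprime k K}"
    using False assms totatives_less[of _ K]
    by (auto simp: in_totatives_iff intro!: Nat.gr0I)
  then show ?thesis by (simp add: totient_def)
qed

text \<open>
  As \<open>Q\<close> is invertible modulo \<open>K\<close>, the residues of \<open>i + Q * j\<close> run through all classes when \<open>j\<close> runs
  through a full period of length \<open>K\<close>, and \<open>L\<close> consists of \<open>L / K\<close> such periods.
\<close>
lemma card_coprime_progression:
  fixes K Q L i :: nat
  assumes "K > 0" "K dvd L" "coprime Q K"
  shows "card {j. j < L \<and> coprime (i + Q * j) K} * K = L * totient K"
proof -
  obtain M where M: "L = K * M" using assms(2) by blast
  have coprime_mod: "coprime (k mod K) K \<longleftrightarrow> coprime k K" for k
    by (metis coprime_iff_gcd_eq_1 gcd.commute gcd_red_nat)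
  have "coprime (i + Q * (j mod K)) K \<longleftrightarrow> coprime (i + Q * j) K" for j
    by (metis coprime_mod mod_add_right_eq mod_mult_right_eq)
  then have "card {j. j < L \<and> coprime (i + Q * j) K}
      = card {j. j < K \<and> coprime (i + Q * j) K} * M"
    unfolding M using card_mod_periodic[OF assms(1), of M "\<lambda>j. coprime (i + Q * j) K"] by simp
  also have "card {j. j < K \<and> coprime (i + Q * j) K} = card {k. k < K \<and> coprime k K}"
  proof (rule bij_betw_same_card)
    let ?f = "\<lambda>j. (i + Q * j) mod K"
    have inj: "inj_on ?f {..<K}"
    proof (rule inj_onI)
      fix x y assume "x \<in> {..<K}" "y \<in> {..<K}" "?f x = ?f y"
      then have "[i + Q * x = i + Q * y] (mod K)" by (simp add: cong_def)
      then have "[x = y] (mod K)"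
        using assms(3) by (simp add: cong_add_lcancel_nat cong_mult_lcancel_nat)
      then show "x = y"
        using \<open>x \<in> {..<K}\<close> \<open>y \<in> {..<K}\<close> by (simp add: cong_def)
    qed
    moreover have "?f ` {..<K} \<subseteq> {..<K}" using assms(1) by auto
    ultimately have im: "?f ` {..<K} = {..<K}" by (simp add: endo_inj_surj)
    have "?f ` {j. j < K \<and> coprime (i + Q * j) K} = {k. k < K \<and> coprime k K}"
    proof (intro equalityI subsetI)
      fix k assume k: "k \<in> {k. k < K \<and> coprime k K}"
      then have "k \<in> ?f ` {..<K}" unfolding im by simp
      then obtain j where "j < K" "k = ?f j" by auto
      with k show "k \<in> ?f ` {j. j < K \<and> coprime (i + Q * j) K}"
        by (auto simp: coprime_mod)
    qed (use assms(1) in \<open>auto simp: coprime_mod\<close>)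
    moreover have "inj_on ?f {j. j < K \<and> coprime (i + Q * j) K}"
      using inj by (rule inj_on_subset) auto
    ultimately show "bij_betw ?f {j. j < K \<and> coprime (i + Q * j) K} {k. k < K \<and> coprime k K}"
      by (simp add: bij_betw_def)
  qed
  finally show ?thesis
    by (simp add: totient_card_lessThan[OF assms(1)] M)
qed

text \<open>
  A condition on \<open>k mod Q\<close> and coprimality to \<open>K\<close> are independent when \<open>Q\<close> and \<open>K\<close> are coprime:
  among the \<open>k\<close> in any fixed residue class modulo \<open>Q\<close>, the proportion of those coprime to \<open>K\<close> is
  \<open>totient K / K\<close>.
\<close>
lemma card_periodic_coprime:
  fixes K Q L :: nat
  assumes "Q > 0" "K > 0" "K dvd L" "coprime Q K"
  shows "card {k. k < Q * L \<and> A (k mod Q) \<and> coprime k K} * K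
    = card {k. k < Q * L \<and> A (k mod Q)} * totient K"
proof -
  have "card {k. k < Q * L \<and> A (k mod Q) \<and> coprime k K}
      = (\<Sum>i | i < Q. card {j. j < L \<and> A i \<and> coprime (i + Q * j) K})"
    using card_mod_product[OF assms(1), of L "\<lambda>i j. A i \<and> coprime (i + Q * j) K"] by simp
  then have "card {k. k < Q * L \<and> A (k mod Q) \<and> coprime k K} * K
      = (\<Sum>i | i < Q. card {j. j < L \<and> A i \<and> coprime (i + Q * j) K} * K)"
    by (simp add: sum_distrib_right)
  also have "\<dots> = (\<Sum>i | i < Q. if A i then L * totient K else 0)"
    by (rule sum.cong) (auto simp: card_coprime_progression[OF assms(2-4)])
  also have "\<dots> = card {i. i < Q \<and> A i} * L * totient K"
    by (simp add: sum.If_cases Collect_conj_eq)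
  finally show ?thesis
    unfolding card_mod_periodic[OF assms(1)] .
qed

text \<open>
  The set splits into the orbits of \<open>f\<close>. An orbit cannot have two elements, because \<open>f (f x) = x\<close>
  and \<open>f (f (f x)) = x\<close> would make \<open>x\<close> a fixed point.
\<close>
lemma card_free_order_3:
  assumes fin: "finite A" and f: "\<And>x. x \<in> A \<Longrightarrow> f x \<in> A" "\<And>x. x \<in> A \<Longrightarrow> f (f (f x)) = x"
    "\<And>x. x \<in> A \<Longrightarrow> f x \<noteq> x"
  shows "3 dvd card A"
proof -
  let ?o = "\<lambda>x. {x, f x, f (f x)}"
  have "3 * card (?o ` A) = card (\<Union>(?o ` A))"
  proof (rule card_partition)
    show "finite (?o ` A)" using fin by simp
    show "finite (\<Union>(?o ` A))" using fin by simp
    fix c assume "c \<in> ?o ` A"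
    then obtain x where x: "x \<in> A" "c = ?o x" by blast
    have "f x \<noteq> f (f x)" "f x \<noteq> x" using x f by metis+
    moreover have "f (f x) \<noteq> x" using x f by metis
    ultimately show "card c = 3" using x by simp
  next
    fix c d assume "c \<in> ?o ` A" "d \<in> ?o ` A" "c \<noteq> d"
    then obtain x y where x: "x \<in> A" "c = ?o x" and y: "y \<in> A" "d = ?o y" by blast
    have orbit: "?o z = ?o w" if "w \<in> A" "z \<in> ?o w" for z w
      using that f by auto
    show "c \<inter> d = {}"
    proof (rule ccontr)
      assume "c \<inter> d \<noteq> {}"
      then obtain z where "z \<in> c" "z \<in> d" by blast
      then have "?o z = c" "?o z = d" using orbit x y by metis+
      with \<open>c \<noteq> d\<close> show False by simp
    qed
  qed
  moreover have "\<Union>(?o ` A) = A" using f(1) by auto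
  ultimately show ?thesis by (metis dvd_triv_left)
qed

lemma max_divisor_not_dvd_3:
  fixes N K :: nat
  assumes "N > 0" and K: "K = Max {k. k dvd N \<and> \<not> 3 dvd k}"
  obtains v where "N = 3 ^ v * K" "\<not> 3 dvd K"
proof -
  obtain N' where N': "N = 3 ^ multiplicity 3 N * N'" "\<not> 3 dvd N'"
    using multiplicity_decompose'[of N 3] assms(1) by auto
  have "Max {k. k dvd N \<and> \<not> 3 dvd k} = N'"
  proof (rule Max_eqI)
    show "finite {k. k dvd N \<and> \<not> 3 dvd k}"
      using assms(1) by (auto intro: finite_subset[OF _ finite_divisors_nat])
    show "N' \<in> {k. k dvd N \<and> \<not> 3 dvd k}"
      using N' by (metis (mono_tags) dvd_triv_right mem_Collect_eq)
    fix k assume "k \<in> {k. k dvd N \<and> \<not> 3 dvd k}"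
    then have k: "k dvd 3 ^ multiplicity 3 N * N'" "\<not> 3 dvd k"
      using N'(1) by simp_all
    have "coprime 3 k" using k(2) by (intro prime_imp_coprime) simp_all
    then have "coprime k (3 ^ multiplicity 3 N)" by (simp add: coprime_commute)
    with k(1) have "k dvd N'" by (simp add: coprime_dvd_mult_right_iff)
    moreover have "N' > 0" using N' by (auto intro: Nat.gr0I)
    ultimately show "k \<le> N'" by (rule dvd_imp_le)
  qed
  then show thesis using that N' K by metis
qed

lemma repunit_eq:
  fixes q m :: nat
  assumes "q > 0"
  shows "(\<Sum>i<m. q ^ i) * (q - 1) + 1 = q ^ m"
proof (induction m)
  case (Suc m)
  obtain e where e: "q = Suc e" using assms by (cases q) auto
  show ?case using Suc by (simp add: e algebra_simps)
qed simp

lemma repunit_mod_3: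
  fixes q m :: nat
  assumes "q mod 3 = 1"
  shows "(\<Sum>i<m. q ^ i) mod 3 = m mod 3"
proof -
  have "q ^ i mod 3 = 1" for i
    using power_mod[of q 3 i] assms by simp
  then show ?thesis
    by (subst mod_sum_eq[symmetric]) simp
qed

section \<open>Finite fields through a primitive element\<close>

locale primitive_element =
  fixes g :: "'a::{field,finite}" and n :: nat
  assumes n_eq: "n = card (UNIV :: 'a set) - 1"
    and powers_g: "UNIV - {0} = range (\<lambda>k. g ^ k)"

text \<open>
  The multiplicative group of a finite field is cyclic; the type is viewed as a field whose carrier
  is the whole type.
\<close>
lemma primitive_element_exists:
  "\<exists>g::'a::{field,finite}. primitive_element g (card (UNIV :: 'a set) - 1)"
proof -
  define R :: "'a ring" where
    "R = \<lparr>carrier = UNIV, monoid.mult = (*), one = 1, ring.zero = 0, add = (+)\<rparr>"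
  have "\<exists>y. y + x = 0" for x :: 'a
    using add.left_inverse by blast
  moreover have "\<exists>y. x * y = 1" if "x \<noteq> 0" for x :: 'a
    using that by (intro exI[of _ "inverse x"]) simp
  ultimately interpret R: field R
    unfolding R_def by unfold_locales (auto simp: algebra_simps Units_def)
  have pow: "a [^]\<^bsub>R\<^esub> k = a ^ k" for a :: 'a and k :: nat
    by (induction k) (auto simp: R_def nat_pow_def)
  obtain a where "carrier (mult_of R) = {a [^]\<^bsub>R\<^esub> i | i::nat. i \<in> UNIV}"
    using R.finite_field_mult_group_has_gen by auto
  then have "UNIV - {0} = range (\<lambda>k. a ^ k)"
    unfolding pow by (auto simp: R_def)
  then show ?thesis
    unfolding primitive_element_def by blast
qed

context primitive_element
begin

lemma g_nonzero [simp]: "g \<noteq> 0"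
proof
  assume "g = 0"
  then have "g ^ 1 \<notin> UNIV - {0}" by simp
  then show False unfolding powers_g by blast
qed

lemma card_nonzero: "card (UNIV - {0::'a}) = n"
  by (simp add: n_eq)

lemma n_pos: "n > 0"
proof -
  have "1 \<in> UNIV - {0::'a}" by simp
  then show ?thesis
    unfolding card_nonzero[symmetric] by (metis card_gt_0_iff empty_iff finite)
qed

lemma card_UNIV: "card (UNIV :: 'a set) = n + 1"
  using n_pos n_eq by simp

lemma power_n: "x \<noteq> 0 \<Longrightarrow> x ^ n = (1::'a)"
proof -
  assume x: "x \<noteq> 0"
  have "(\<Prod>y\<in>UNIV-{0}. x * y) = (\<Prod>y\<in>UNIV-{0::'a}. y)"
    by (rule prod.reindex_bij_witness[of _ "\<lambda>y. y / x" "\<lambda>y. x * y"]) (use x in auto)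
  then have "x ^ n * (\<Prod>y\<in>UNIV-{0::'a}. y) = (\<Prod>y\<in>UNIV-{0::'a}. y)"
    by (simp only: prod.distrib prod_constant card_nonzero)
  then show "x ^ n = 1" by simp
qed

lemma power_exponent_mod: "g ^ (k mod n) = g ^ k"
proof -
  have "g ^ k = g ^ (n * (k div n) + k mod n)" by simp
  also have "\<dots> = g ^ (k mod n)"
    by (simp only: power_add power_mult) (simp add: power_n)
  finally show ?thesis by simp
qed

lemma bij_powers: "bij_betw (\<lambda>k. g ^ k) {..<n} (UNIV - {0})"
proof -
  have im: "(\<lambda>k. g ^ k) ` {..<n} = UNIV - {0}"
  proof -
    have "g ^ k \<in> (\<lambda>k. g ^ k) ` {..<n}" for k
      using power_exponent_mod[of k] n_pos by (metis imageI lessThan_iff mod_less_divisor)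
    then show ?thesis unfolding powers_g by blast
  qed
  then have "inj_on (\<lambda>k. g ^ k) {..<n}"
    by (intro eq_card_imp_inj_on) (simp_all add: card_nonzero)
  with im show ?thesis by (simp add: bij_betw_def)
qed

lemma obtain_log:
  assumes "x \<noteq> 0"
  obtains k where "x = g ^ k"
  using assms powers_g by blast

lemma power_eq_iff: "g ^ i = g ^ j \<longleftrightarrow> [i = j] (mod n)"
proof -
  have "g ^ i = g ^ j \<longleftrightarrow> g ^ (i mod n) = g ^ (j mod n)"
    by (simp add: power_exponent_mod)
  also have "\<dots> \<longleftrightarrow> i mod n = j mod n"
    using bij_powers n_pos by (auto simp: bij_betw_def inj_on_def)
  finally show ?thesis by (simp add: cong_def)
qed

lemma power_eq_1_iff: "g ^ k = 1 \<longleftrightarrow> n dvd k"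
  using power_eq_iff[of k 0] by (simp add: cong_0_iff)

lemma is_power_iff:
  assumes "d dvd n"
  shows "(\<exists>x. g ^ k = x ^ d) \<longleftrightarrow> d dvd k"
proof
  assume "\<exists>x. g ^ k = x ^ d"
  then obtain x where x: "g ^ k = x ^ d" by blast
  have "d > 0" using assms n_pos by (auto intro: Nat.gr0I)
  with x have "x \<noteq> 0" by (metis g_nonzero power_eq_0_iff power_not_zero)
  then obtain l where "x = g ^ l" by (rule obtain_log)
  with x have "[k = l * d] (mod n)"
    by (simp add: power_eq_iff flip: power_mult)
  then show "d dvd k"
    using assms by (metis cong_dvd_iff cong_dvd_modulus_nat dvd_triv_right)
next
  assume "d dvd k"
  then show "\<exists>x. g ^ k = x ^ d"
    by (metis dvd_div_mult_self power_mult)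
qed

lemma N_free_power_iff:
  assumes "N dvd n"
  shows "N_free N (g ^ k) \<longleftrightarrow> coprime k N"
proof -
  have "N_free N (g ^ k) \<longleftrightarrow> (\<forall>d. d dvd N \<longrightarrow> d dvd k \<longrightarrow> d = 1)"
    unfolding N_free_def using is_power_iff[OF dvd_trans[OF _ assms]] by auto
  also have "\<dots> \<longleftrightarrow> coprime k N"
    by (auto simp: coprime_def)
  finally show ?thesis .
qed

lemma of_nat_card_UNIV: "of_nat (n + 1) = (0::'a)"
  using CHAR_dvd_CARD[where 'a='a] by (simp only: of_nat_eq_0_iff_char_dvd card_UNIV)

text \<open>
  The substitution \<open>x \<mapsto> g x\<close> multiplies the sum by \<open>g ^ j\<close>, so it vanishes unless \<open>g ^ j = 1\<close>. In
  that case each of the \<open>n\<close> non-zero elements contributes \<open>1\<close>, and \<open>n = -1\<close> in the field. For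
  \<open>j = 0\<close> the summand at zero adds another \<open>1\<close>, which is why that exponent behaves differently.
\<close>
lemma sum_powers:
  "(\<Sum>x\<in>UNIV. x ^ j) = (if j > 0 \<and> n dvd j then -1 else (0::'a))"
proof (cases "n dvd j")
  case True
  then obtain l where l: "j = n * l" by blast
  show ?thesis
  proof (cases "j = 0")
    case True
    then show ?thesis using of_nat_card_UNIV by (simp add: card_UNIV)
  next
    case False
    have "(\<Sum>x\<in>UNIV. x ^ j) = (\<Sum>x\<in>UNIV-{0::'a}. x ^ j) + 0 ^ j"
      by (subst sum.remove[of _ 0]) auto
    also have "(\<Sum>x\<in>UNIV-{0::'a}. x ^ j) = (\<Sum>x\<in>UNIV-{0::'a}. 1)"
      by (rule sum.cong) (auto simp: l power_mult power_n)
    also have "\<dots> = -1"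
    proof -
      have "of_nat n + 1 = (0::'a)" using of_nat_card_UNIV by (simp add: add.commute)
      then show ?thesis by (simp only: sum_constant card_nonzero eq_neg_iff_add_eq_0 mult_1_right)
    qed
    finally show ?thesis using False True by simp
  qed
next
  case False
  have "(\<Sum>x\<in>UNIV. x ^ j) = (\<Sum>x\<in>UNIV. (g * x) ^ j)"
    by (rule sum.reindex_bij_witness[of _ "\<lambda>y. g * y" "\<lambda>y. y / g"]) auto
  also have "\<dots> = g ^ j * (\<Sum>x\<in>UNIV. x ^ j)"
    by (simp add: power_mult_distrib sum_distrib_left)
  finally have "(g ^ j - 1) * (\<Sum>x\<in>UNIV. x ^ j) = 0"
    by (simp add: algebra_simps)
  moreover have "g ^ j \<noteq> 1" using False power_eq_1_iff by blast
  ultimately show ?thesis using False by simp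
qed

lemma card_cube_roots:
  assumes "3 dvd n" "x \<noteq> 0"
  shows "card {y::'a. y ^ 3 = x ^ 3} = 3"
proof -
  define w where "w = g ^ (n div 3)"
  have w3: "w ^ 3 = 1"
    unfolding w_def using assms(1) by (simp flip: power_mult add: power_eq_1_iff)
  have w1: "w \<noteq> 1"
    unfolding w_def power_eq_1_iff using assms(1) n_pos
    by (auto elim!: dvdE dest: dvd_imp_le)
  have fac: "(w - 1) * (w^2 + w + 1) = 0"
    using w3 by (simp add: power2_eq_square power3_eq_cube algebra_simps)
  have w2: "w^2 = - w - 1"
  proof -
    have "w^2 + w + 1 = 0" using fac w1 by simp
    then show ?thesis by (simp add: eq_diff_eq eq_neg_iff_add_eq_0 add_ac)
  qed
  \<comment> \<open>\<open>w\<close> is a primitive cube root of unity\<close>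
  have "y ^ 3 = x ^ 3 \<longleftrightarrow> (y - x) * (y - w * x) * (y - w^2 * x) = 0" for y
  proof -
    have "(y - x) * (y - w * x) * (y - w^2 * x)
        = y^3 - (1 + w + w^2) * x * y^2 + (w + w^2 + w^3) * x^2 * y - w^3 * x^3"
      by (simp add: power2_eq_square power3_eq_cube algebra_simps)
    also have "\<dots> = y^3 - x^3"
      unfolding w3 w2 by simp
    finally show ?thesis by simp
  qed
  then have "{y. y ^ 3 = x ^ 3} = {x, w * x, w^2 * x}"
    by auto
  moreover have "w * x \<noteq> x" using w1 assms by simp
  moreover have "w^2 \<noteq> 1"
  proof
    assume "w^2 = 1"
    with w3 have "w = 1" by (simp add: power2_eq_square power3_eq_cube)
    with w1 show False by simp
  qed
  moreover have "w^2 \<noteq> w"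
    using w1 w3 by (auto simp: power2_eq_square)
  ultimately show ?thesis
    using assms(2) by simp
qed

lemma card_roots_of_unity:
  assumes "n = e * f"
  shows "card {x::'a. x ^ e = 1} = e" and "{x::'a. x ^ e = 1} = {x. \<exists>j. x = g ^ (f * j)}"
proof -
  have pos: "e > 0" "f > 0" using assms n_pos by auto
  have root: "(g ^ k) ^ e = 1 \<longleftrightarrow> f dvd k" for k
  proof -
    have "(g ^ k) ^ e = 1 \<longleftrightarrow> e * f dvd e * k"
      by (simp only: power_mult[symmetric] power_eq_1_iff assms mult.commute[of k])
    then show ?thesis using pos by simp
  qed
  show set: "{x::'a. x ^ e = 1} = {x. \<exists>j. x = g ^ (f * j)}"
  proof (intro equalityI subsetI)
    fix x :: 'a assume "x \<in> {x. x ^ e = 1}"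
    then have x: "x ^ e = 1" by simp
    with pos have "x \<noteq> 0" by (metis power_0_left zero_neq_one less_not_refl)
    then obtain k where k: "x = g ^ k" by (rule obtain_log)
    from x have "f dvd k" unfolding k root .
    then show "x \<in> {x. \<exists>j. x = g ^ (f * j)}" unfolding k by blast
  next
    fix x :: 'a assume "x \<in> {x. \<exists>j. x = g ^ (f * j)}"
    then obtain j where j: "x = g ^ (f * j)" by blast
    have "x ^ e = 1" unfolding j root by simp
    then show "x \<in> {x. x ^ e = 1}" by simp
  qed
  have "bij_betw (\<lambda>j. g ^ (f * j)) {..<e} {x::'a. x ^ e = 1}"
    unfolding bij_betw_def
  proof
    show "inj_on (\<lambda>j. g ^ (f * j)) {..<e}"
    proof (rule inj_onI)
      fix i j assume ij: "i \<in> {..<e}" "j \<in> {..<e}" "g ^ (f * i) = g ^ (f * j)"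
      then have "f * i < n" "f * j < n" using pos by (simp_all add: assms mult.commute[of e])
      with ij(3) have "f * i = f * j" by (simp add: power_eq_iff cong_def)
      then show "i = j" using pos by simp
    qed
    show "(\<lambda>j. g ^ (f * j)) ` {..<e} = {x. x ^ e = 1}"
    proof (intro equalityI subsetI)
      fix x :: 'a assume "x \<in> (\<lambda>j. g ^ (f * j)) ` {..<e}"
      then show "x \<in> {x. x ^ e = 1}" unfolding set by blast
    next
      fix x :: 'a assume "x \<in> {x. x ^ e = 1}"
      then obtain j where j: "x = g ^ (f * j)" unfolding set by blast
      have "g ^ (f * j) = g ^ (f * (j mod e))"
        unfolding power_eq_iff cong_def mult_mod_right assms mult.commute[of e] by simp
      moreover have "j mod e \<in> {..<e}" using pos by simp
      ultimately show "x \<in> (\<lambda>j. g ^ (f * j)) ` {..<e}" unfolding j by (rule image_eqI)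
    qed
  qed
  then show "card {x::'a. x ^ e = 1} = e"
    using bij_betw_same_card by fastforce
qed

text \<open>
  Cubing is three-to-one on the non-zero elements.
\<close>
lemma card_cube_multiples:
  assumes "3 dvd n" "b \<noteq> 0"
  shows "card {x. x \<noteq> 0 \<and> P (b * x ^ 3)} = 3 * card {u::'a. (\<exists>x. x \<noteq> 0 \<and> u = b * x ^ 3) \<and> P u}"
proof -
  let ?A = "{x. x \<noteq> 0 \<and> P (b * x ^ 3)}" and ?B = "{u. (\<exists>x. x \<noteq> 0 \<and> u = b * x ^ 3) \<and> P u}"
  have fibre: "card {x. b * x ^ 3 = u} = 3" if "u \<in> ?B" for u
  proof -
    from that obtain y where y: "y \<noteq> 0" "u = b * y ^ 3" by blast
    then have "{x. b * x ^ 3 = u} = {x. x ^ 3 = y ^ 3}" using assms(2) by auto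
    then show ?thesis using card_cube_roots[OF assms(1) y(1)] by simp
  qed
  have "?A = (\<Union>u\<in>?B. {x. b * x ^ 3 = u})" using assms(2) by auto
  then have "card ?A = card (\<Union>u\<in>?B. {x. b * x ^ 3 = u})" by (rule arg_cong)
  moreover have "card (\<Union>u\<in>?B. {x. b * x ^ 3 = u}) = (\<Sum>u\<in>?B. card {x. b * x ^ 3 = u})"
    by (rule card_UN_disjoint) (simp, simp, blast)
  moreover have "(\<Sum>u\<in>?B. card {x. b * x ^ 3 = u}) = (\<Sum>u\<in>?B. 3)"
    by (rule sum.cong[OF refl fibre])
  ultimately show ?thesis by (simp only: sum_constant mult.commute) simp
qed

text \<open>
  The polynomial \<open>X ^ p - X\<close> has at most \<open>p\<close> roots, and the \<open>p\<close> multiples of \<open>1\<close> already are roots.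
\<close>
lemma prime_field_elements:
  assumes p: "prime p" "CHAR('a) = p" and x: "x ^ p = (x::'a)"
  shows "\<exists>j. x = of_nat j"
proof -
  let ?P = "monom 1 p - monom 1 1 :: 'a poly"
  have p1: "p > 1" using p(1) prime_gt_1_nat by blast
  have "coeff ?P p = 1" using p1 by (simp add: coeff_diff)
  then have nz: "?P \<noteq> 0" by (rule contrapos_pn) (simp only: coeff_0 zero_neq_one not_False_eq_True)
  have "degree ?P \<le> p"
    using p1 by (intro degree_diff_le) (auto simp: degree_monom_eq)
  moreover have roots: "{x. poly ?P x = 0} = {x. x ^ p = x}" by (simp add: poly_monom)
  ultimately have le: "card {x::'a. x ^ p = x} \<le> p"
    using card_poly_roots_bound[OF nz] by simp
  have sub: "of_nat ` {..<p} \<subseteq> {x::'a. x ^ p = x}"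
  proof -
    have "(of_nat j :: 'a) ^ p = of_nat j" for j
    proof (induction j)
      case 0
      then show ?case using p1 by simp
    next
      case (Suc j)
      have "(1 + of_nat j :: 'a) ^ p = 1 ^ p + of_nat j ^ p"
        by (rule freshmans_dream) (simp_all add: p)
      then show ?case by (simp add: Suc.IH)
    qed
    then show ?thesis by auto
  qed
  have "inj_on (of_nat :: nat \<Rightarrow> 'a) {..<p}"
  proof (rule inj_onI)
    fix i j assume *: "i \<in> {..<p}" "j \<in> {..<p}" "(of_nat i :: 'a) = of_nat j"
    then show "i = j" by (simp add: of_nat_eq_iff_cong_CHAR p cong_def)
  qed
  then have "card (of_nat ` {..<p} :: 'a set) = p" by (simp add: card_image)
  with le sub have "of_nat ` {..<p} = {x::'a. x ^ p = x}"
    by (intro card_seteq) auto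
  with x show ?thesis by auto
qed

lemma CHAR_eq:
  assumes p: "prime p" and card: "n + 1 = p ^ e"
  shows "CHAR('a) = p"
proof -
  have "CHAR('a) dvd p ^ e"
    using CHAR_dvd_CARD[where 'a='a] by (simp only: card_UNIV card)
  then obtain i where i: "CHAR('a) = p ^ i"
    using p divides_primepow_nat by blast
  moreover have "i \<noteq> 0" by (rule notI) (use i in simp)
  ultimately have "p dvd CHAR('a)" by simp
  moreover have "prime CHAR('a)"
    by (rule prime_CHAR_semidom) (simp add: finite_imp_CHAR_pos)
  ultimately show "CHAR('a) = p"
    using p primes_dvd_imp_eq by blast
qed

text \<open>
  The power \<open>u ^ a\<close> is the cubic residue symbol of \<open>u\<close> with values in the field itself. The
  identity is the usual formula for the number of cube roots as a sum over the three cubic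
  characters, read modulo the characteristic; thanks to \<open>a > 0\<close> it includes \<open>u = 0\<close>.
\<close>
lemma card_cube_root_set:
  assumes "n = 3 * a"
  shows "of_nat (card {x. x ^ 3 = u}) = (1 + u ^ a + u ^ (2 * a) :: 'a)"
proof -
  have a: "a > 0" using assms n_pos by simp
  show ?thesis
  proof (cases "u = 0")
    case True
    then show ?thesis using a by (simp add: power_0_left)
  next
    case False
    then obtain k where k: "u = g ^ k" by (rule obtain_log)
    show ?thesis
    proof (cases "3 dvd k")
      case True
      then obtain l where l: "k = 3 * l" by blast
      have x: "u = (g ^ l) ^ 3" by (simp add: k l mult.commute flip: power_mult)
      have "card {x. x ^ 3 = u} = 3"
        unfolding x by (rule card_cube_roots) (simp_all add: assms)
      moreover have "u ^ a = 1"
        by (simp add: k l assms power_eq_1_iff mult_ac flip: power_mult)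
      ultimately show ?thesis by (simp add: mult.commute[of 2 a] power_mult)
    next
      case False
      have "u \<noteq> x ^ 3" for x
        using is_power_iff[of 3 k] False k assms by auto
      then have "{x. x ^ 3 = u} = {}" by auto
      moreover have "u ^ a \<noteq> 1"
        using False a by (simp add: k assms power_eq_1_iff flip: power_mult)
      moreover have "n = a + a + a" using assms by simp
      then have "(u ^ a - 1) * (1 + u ^ a + u ^ (2 * a)) = u ^ n - 1"
        by (simp add: mult_2_right power_add algebra_simps)
      then have "(u ^ a - 1) * (1 + u ^ a + u ^ (2 * a)) = 0"
        using \<open>u \<noteq> 0\<close> by (simp add: power_n)
      ultimately show ?thesis by simp
    qed
  qed
qed

text \<open>
  A Jacobi sum modulo the characteristic: after expanding \<open>(1 - u) ^ l\<close> only monomials whose exponent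
  is a positive multiple of \<open>n\<close> survive the summation, and \<open>i + l < 2 * n\<close> leaves \<open>u ^ n\<close> alone.
\<close>
lemma beta_sum:
  assumes "i \<le> n" "i + l < 2 * n"
  shows "(\<Sum>u\<in>UNIV. u ^ i * (1 - u) ^ l)
    = (if n \<le> i + l then - (of_nat (l choose (n - i)) * (- 1) ^ (n - i)) else (0::'a))"
proof -
  have "(1 - u) ^ l = (\<Sum>k\<le>l. of_nat (l choose k) * (- 1) ^ k * u ^ k)" for u :: 'a
  proof -
    have "(1 - u) ^ l = (- u + 1) ^ l" by simp
    also have "\<dots> = (\<Sum>k\<le>l. of_nat (l choose k) * (- 1) ^ k * u ^ k)"
      unfolding binomial_ring by (simp add: power_minus[of u] mult_ac)
    finally show ?thesis .
  qed
  then have "(\<Sum>u\<in>UNIV. u ^ i * (1 - u) ^ l)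
      = (\<Sum>u\<in>UNIV. \<Sum>k\<le>l. of_nat (l choose k) * (- 1) ^ k * (u::'a) ^ (i + k))"
    by (simp add: sum_distrib_left power_add mult_ac)
  also have "\<dots> = (\<Sum>k\<le>l. of_nat (l choose k) * (- 1) ^ k * (\<Sum>u\<in>UNIV. (u::'a) ^ (i + k)))"
    by (subst sum.swap) (simp add: sum_distrib_left)
  also have "\<dots> = (\<Sum>k\<le>l. if k = n - i then - (of_nat (l choose (n - i)) * (- 1) ^ (n - i)) else 0)"
  proof (rule sum.cong)
    fix k assume k: "k \<in> {..l}"
    have "0 < i + k \<and> n dvd i + k \<longleftrightarrow> k = n - i"
    proof
      assume *: "0 < i + k \<and> n dvd i + k"
      then obtain j where j: "i + k = n * j" by blast
      with * have "j > 0" by (auto intro: Nat.gr0I)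
      moreover have "k \<le> l" using k by simp
      then have "n * j < n * 2" using j assms(2) by linarith
      then have "j < 2" by (simp only: mult_less_cancel1)
      ultimately have "j = 1" by simp
      with j show "k = n - i" by simp
    next
      assume "k = n - i"
      with assms(1) show "0 < i + k \<and> n dvd i + k" using n_pos by simp
    qed
    then show "of_nat (l choose k) * (- 1) ^ k * (\<Sum>u\<in>UNIV. (u::'a) ^ (i + k))
        = (if k = n - i then - (of_nat (l choose (n - i)) * (- 1) ^ (n - i)) else 0)"
      unfolding sum_powers by simp
  qed simp
  also have "\<dots> = (if n - i \<le> l then - (of_nat (l choose (n - i)) * (- 1) ^ (n - i)) else 0)"
    by simp
  also have "n - i \<le> l \<longleftrightarrow> n \<le> i + l" by auto
  finally show ?thesis .
qed

text \<open>
  The number of points is a sum over \<open>u\<close> of the number of cube roots of \<open>u\<close> and of \<open>1 - u\<close>, hence a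
  sum of nine terms of the form treated in \<open>beta_sum\<close>, with exponents from \<open>{0, a, 2 * a}\<close>. Those of
  total degree below \<open>n = 3 * a\<close> vanish, the two of degree \<open>n\<close> give \<open>-1\<close> each, and the pair
  \<open>(2 * a, 2 * a)\<close> gives the binomial coefficient.
\<close>
lemma card_fermat_cubic:
  assumes a: "n = 3 * a"
  shows "of_nat (card {(x, y). x ^ 3 + y ^ 3 = (1::'a)}) = - 2 - (of_nat ((2 * a) choose a) :: 'a)"
proof -
  let ?v = "\<lambda>u::'a. card {x. x ^ 3 = u}"
  define B where "B i l = (\<Sum>u\<in>UNIV. u ^ i * (1 - u) ^ l :: 'a)" for i l
  have a0: "a > 0" using a n_pos by simp
  have "{(x, y). x ^ 3 + y ^ 3 = (1::'a)} = (\<Union>u. {x. x ^ 3 = u} \<times> {y. y ^ 3 = 1 - u})"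
    by (auto simp: algebra_simps)
  also have "card \<dots> = (\<Sum>u\<in>UNIV. ?v u * ?v (1 - u))"
    by (subst card_UN_disjoint) (auto simp: card_cartesian_product)
  finally have "of_nat (card {(x, y). x ^ 3 + y ^ 3 = (1::'a)})
      = (\<Sum>u\<in>(UNIV::'a set). (1 + u ^ a + u ^ (2 * a)) * (1 + (1 - u) ^ a + (1 - u) ^ (2 * a)))"
    by (simp add: card_cube_root_set[OF a])
  also have "\<dots> = (\<Sum>i\<in>{0, a, 2 * a}. \<Sum>l\<in>{0, a, 2 * a}. B i l)"
    using a0 by (simp add: B_def sum.distrib algebra_simps)
  also have "\<dots> = - ((- 1) ^ (2 * a)) - (- 1) ^ a - of_nat ((2 * a) choose a) * (- 1) ^ a"
  proof -
    have B: "B i l = (if n \<le> i + l then - (of_nat (l choose (n - i)) * (- 1) ^ (n - i)) else 0)"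
      if "i \<le> n" "i + l < 2 * n" for i l
      unfolding B_def by (rule beta_sum[OF that])
    show ?thesis
      using a a0 by (simp add: B)
  qed
  also have "(- 1 :: 'a) ^ a = 1"
  proof -
    have "(- 1 :: 'a) ^ n = 1" by (rule power_n) simp
    then show ?thesis
      by (simp add: a power_mult)
  qed
  also have "(- 1 :: 'a) ^ (2 * a) = 1" by simp
  finally show ?thesis by simp
qed

text \<open>
  The elements \<open>1\<close>, \<open>g\<close>, \<open>g\<^sup>2\<close> represent the three classes of non-zero elements modulo cubes, each of
  size \<open>n / 3\<close>.
\<close>
lemma sum_cubic_classes:
  fixes f :: "'a \<Rightarrow> complex"
  assumes a: "n = 3 * a" and f: "\<And>x u. u \<noteq> 0 \<Longrightarrow> f (x * u ^ 3) = f x"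
  shows "(\<Sum>x\<in>UNIV-{0}. f x) = of_nat a * (f 1 + f g + f (g ^ 2))"
proof -
  have "(\<Sum>x\<in>UNIV-{0}. f x) = (\<Sum>k<n. f (g ^ k))"
    by (rule sum.reindex_bij_betw[OF bij_powers, symmetric])
  also have "\<dots> = of_nat a * (f 1 + f g + f (g ^ 2))"
    unfolding a
  proof (induction a)
    case (Suc b)
    have "f (g ^ (3 * b + i)) = f (g ^ i)" for i
      using f[of "g ^ b" "g ^ i"] by (simp add: power_add mult_ac flip: power_mult)
    from this[of 0] this[of 1] this[of 2]
    have "f (g ^ (3 * b)) = f 1" "f (g ^ (3 * b + 1)) = f g" "f (g ^ (3 * b + 2)) = f (g ^ 2)"
      by simp_all
    moreover have "3 * Suc b = Suc (Suc (Suc (3 * b)))" by simp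
    then have "(\<Sum>k<3 * Suc b. f (g ^ k))
        = (\<Sum>k<3 * b. f (g ^ k)) + f (g ^ (3 * b)) + f (g ^ (3 * b + 1)) + f (g ^ (3 * b + 2))"
      by (simp only: sum.lessThan_Suc) simp
    ultimately show ?case
      using Suc.IH by (simp only: of_nat_Suc) (simp add: algebra_simps)
  qed simp
  finally show ?thesis .
qed

lemma card_two_cubes:
  assumes "3 dvd n"
  shows "card {(x, y). x ^ 3 + y ^ 3 = (0::'a)} = 1 + 3 * n"
proof -
  have "{(x, y). x ^ 3 + y ^ 3 = (0::'a)} = (SIGMA x:UNIV. {y. y ^ 3 = (- x) ^ 3})"
    by (auto simp: add_eq_0_iff add.commute)
  then have "card {(x, y). x ^ 3 + y ^ 3 = (0::'a)} = (\<Sum>x\<in>UNIV. card {y::'a. y ^ 3 = (- x) ^ 3})"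
    by (simp add: card_SigmaI)
  also have "\<dots> = (\<Sum>x\<in>UNIV-{0}. card {y::'a. y ^ 3 = (- x) ^ 3}) + 1"
    by (subst sum.remove[of _ 0]) auto
  also have "(\<Sum>x\<in>UNIV-{0}. card {y::'a. y ^ 3 = (- x) ^ 3}) = (\<Sum>x\<in>UNIV-{0::'a}. 3)"
    using card_cube_roots[OF assms] by (intro sum.cong) (auto simp del: power_minus_odd)
  finally show ?thesis by (simp add: card_nonzero)
qed

text \<open>
  Solutions with \<open>z \<noteq> 0\<close> are scaled to solutions of \<open>x\<^sup>3 + y\<^sup>3 = 1\<close> upon division by \<open>-z\<close>.
\<close>
lemma card_three_cubes:
  assumes "3 dvd n"
  shows "card {(z, x, y). x ^ 3 + y ^ 3 + z ^ 3 = (0::'a)}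
    = 1 + 3 * n + n * card {(x, y). x ^ 3 + y ^ 3 = (1::'a)}"
proof -
  let ?E = "\<lambda>z::'a. {(x, y). x ^ 3 + y ^ 3 + z ^ 3 = 0}"
  have "{(z, x, y). x ^ 3 + y ^ 3 + z ^ 3 = (0::'a)} = (SIGMA z:UNIV. ?E z)"
    by auto
  then have "card {(z, x, y). x ^ 3 + y ^ 3 + z ^ 3 = (0::'a)} = (\<Sum>z\<in>UNIV. card (?E z))"
    by (simp add: card_SigmaI)
  also have "\<dots> = (\<Sum>z\<in>UNIV-{0}. card (?E z)) + (1 + 3 * n)"
    by (subst sum.remove[of _ 0]) (auto simp: card_two_cubes[OF assms])
  also have "(\<Sum>z\<in>UNIV-{0}. card (?E z)) = (\<Sum>z\<in>UNIV-{0::'a}. card {(x, y). x ^ 3 + y ^ 3 = (1::'a)})"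
  proof (rule sum.cong)
    fix z :: 'a assume "z \<in> UNIV - {0}"
    then have z: "z \<noteq> 0" by simp
    have "bij_betw (\<lambda>(x, y). (- (x * z), - (y * z))) {(x, y). x ^ 3 + y ^ 3 = 1} (?E z)"
    proof (rule bij_betw_byWitness[where f' = "\<lambda>(x, y). (- (x / z), - (y / z))"])
      have "(- (x * z)) ^ 3 + (- (y * z)) ^ 3 + z ^ 3 = z ^ 3 * (1 - (x ^ 3 + y ^ 3))" for x y
        by (simp add: power_mult_distrib algebra_simps)
      then show "(\<lambda>(x, y). (- (x * z), - (y * z))) ` {(x, y). x ^ 3 + y ^ 3 = 1} \<subseteq> ?E z"
        by auto
      have "(- (x / z)) ^ 3 + (- (y / z)) ^ 3 = 1" if "x ^ 3 + y ^ 3 + z ^ 3 = 0" for x y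
      proof -
        have "(- (x / z)) ^ 3 + (- (y / z)) ^ 3 = - (x ^ 3 + y ^ 3) / z ^ 3"
          by (simp add: power_divide diff_divide_distrib)
        also have "x ^ 3 + y ^ 3 = - (z ^ 3)" using that by (simp add: eq_neg_iff_add_eq_0)
        finally show ?thesis using z by simp
      qed
      then show "(\<lambda>(x, y). (- (x / z), - (y / z))) ` ?E z \<subseteq> {(x, y). x ^ 3 + y ^ 3 = 1}"
        by auto
    qed (use z in auto)
    then show "card (?E z) = card {(x, y). x ^ 3 + y ^ 3 = (1::'a)}"
      by (rule bij_betw_same_card[symmetric])
  qed simp
  finally show ?thesis by (simp add: card_nonzero)
qed

end

section \<open>Cubic exponential sums and their moments\<close>

locale additive_character =
  fixes \<psi> :: "'a::{field,finite} \<Rightarrow> complex"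
  assumes psi_add: "\<psi> (x + y) = \<psi> x * \<psi> y"
    and psi_0: "\<psi> 0 = 1"
    and psi_nontrivial: "\<exists>x. \<psi> x \<noteq> 1"
begin

definition cubic_sum :: "'a \<Rightarrow> complex" where
  "cubic_sum b = (\<Sum>x\<in>UNIV. \<psi> (b * x ^ 3))"

lemma sum_psi_mult: "(\<Sum>b\<in>UNIV. \<psi> (b * z)) = (if z = 0 then of_nat (card (UNIV :: 'a set)) else 0)"
proof (cases "z = 0")
  case True
  then show ?thesis by (simp add: psi_0)
next
  case False
  obtain x where x: "\<psi> x \<noteq> 1" using psi_nontrivial by blast
  have "(\<Sum>b\<in>UNIV. \<psi> (b * z)) = (\<Sum>b\<in>UNIV. \<psi> (b * z + x))"
    by (rule sum.reindex_bij_witness[of _ "\<lambda>b. b + x / z" "\<lambda>b. b - x / z"])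
       (use False in \<open>auto simp: field_simps\<close>)
  also have "\<dots> = (\<Sum>b\<in>UNIV. \<psi> (b * z)) * \<psi> x"
    by (simp add: psi_add sum_distrib_right)
  finally have "(\<Sum>b\<in>UNIV. \<psi> (b * z)) * (\<psi> x - 1) = 0"
    by (simp add: algebra_simps)
  then show ?thesis using x False by simp
qed

text \<open>
  Orthogonality of characters used as a counting device: exchanging the two sums leaves only the
  \<open>t\<close> with \<open>h t = 0\<close>.
\<close>
lemma sum_psi_card:
  fixes h :: "'t::finite \<Rightarrow> 'a"
  shows "(\<Sum>b\<in>UNIV. \<Sum>t\<in>UNIV. \<psi> (b * h t))
    = of_nat (card (UNIV :: 'a set)) * of_nat (card {t. h t = 0})"
proof -
  have "(\<Sum>b\<in>UNIV. \<Sum>t\<in>UNIV. \<psi> (b * h t)) = (\<Sum>t\<in>UNIV. \<Sum>b\<in>UNIV. \<psi> (b * h t))"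
    by (rule sum.swap)
  also have "\<dots> = (\<Sum>t | h t = 0. of_nat (card (UNIV :: 'a set)))"
    by (simp add: sum_psi_mult sum.If_cases)
  finally show ?thesis by (simp add: mult.commute)
qed

text \<open>
  The \<open>k\<close>-th power of a cubic sum is a sum over \<open>k\<close>-tuples, so averaging it over all \<open>b\<close> counts the
  zeros of a sum of \<open>k\<close> cubes.
\<close>
lemma cubic_sum_moments:
  "(\<Sum>b\<in>UNIV. cubic_sum b) = of_nat (card (UNIV :: 'a set))"
  "(\<Sum>b\<in>UNIV. cubic_sum b ^ 2)
    = of_nat (card (UNIV :: 'a set)) * of_nat (card {(x, y). x ^ 3 + y ^ 3 = (0::'a)})"
  "(\<Sum>b\<in>UNIV. cubic_sum b ^ 3)
    = of_nat (card (UNIV :: 'a set)) * of_nat (card {(z, x, y). x ^ 3 + y ^ 3 + z ^ 3 = (0::'a)})"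
proof -
  have "{t::'a. t ^ 3 = 0} = {0}" by auto
  then show "(\<Sum>b\<in>UNIV. cubic_sum b) = of_nat (card (UNIV :: 'a set))"
    unfolding cubic_sum_def sum_psi_card by simp
  have "cubic_sum b ^ 2 = (\<Sum>t\<in>UNIV. \<psi> (b * (\<lambda>(x, y). x ^ 3 + y ^ 3) t))" for b
    unfolding cubic_sum_def power2_eq_square sum_product UNIV_Times_UNIV[symmetric]
    by (simp add: sum.cartesian_product psi_add distrib_left case_prod_beta)
  then show "(\<Sum>b\<in>UNIV. cubic_sum b ^ 2)
      = of_nat (card (UNIV :: 'a set)) * of_nat (card {(x, y). x ^ 3 + y ^ 3 = (0::'a)})"
    by (simp only: sum_psi_card) (simp add: case_prod_unfold)
  have "cubic_sum b ^ 3 = (\<Sum>t\<in>UNIV. \<psi> (b * (\<lambda>(z, x, y). x ^ 3 + y ^ 3 + z ^ 3) t))" for b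
  proof -
    have "cubic_sum b ^ 3 = (\<Sum>z\<in>UNIV. \<Sum>x\<in>UNIV. \<Sum>y\<in>UNIV. \<psi> (b * z ^ 3) * (\<psi> (b * x ^ 3) * \<psi> (b * y ^ 3)))"
    proof -
      have "cubic_sum b ^ 3 = cubic_sum b * (cubic_sum b * cubic_sum b)"
        by (simp add: power3_eq_cube)
      then show ?thesis
        by (simp only: cubic_sum_def sum_product) (simp only: sum_distrib_left)
    qed
    also have "\<dots> = (\<Sum>z\<in>UNIV. \<Sum>x\<in>UNIV. \<Sum>y\<in>UNIV. \<psi> (b * (x ^ 3 + y ^ 3 + z ^ 3)))"
      by (simp add: psi_add distrib_left mult_ac)
    finally show ?thesis
      unfolding UNIV_Times_UNIV[symmetric]
      by (simp add: sum.cartesian_product case_prod_beta)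
  qed
  then show "(\<Sum>b\<in>UNIV. cubic_sum b ^ 3)
      = of_nat (card (UNIV :: 'a set)) * of_nat (card {(z, x, y). x ^ 3 + y ^ 3 + z ^ 3 = (0::'a)})"
    by (simp only: sum_psi_card) (simp add: case_prod_unfold)
qed

lemma cubic_sum_0: "cubic_sum 0 = of_nat (card (UNIV :: 'a set))"
  by (simp add: cubic_sum_def psi_0)

lemma cubic_sum_cube: "u \<noteq> 0 \<Longrightarrow> cubic_sum (b * u ^ 3) = cubic_sum b"
  unfolding cubic_sum_def
  by (rule sum.reindex_bij_witness[of _ "\<lambda>x. x / u" "\<lambda>x. u * x"])
     (auto simp: power_mult_distrib power_divide mult_ac)

end

locale cubic_periods = primitive_element g n + additive_character \<psi>
  for g :: "'a::{field,finite}" and n and \<psi> :: "'a \<Rightarrow> complex" +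
  assumes three_dvd: "3 dvd n"
begin

text \<open>
  With \<open>\<chi>\<close> a cubic character and \<open>J\<close> the Jacobi sum of \<open>\<chi>\<close> with itself, the curve \<open>x\<^sup>3 + y\<^sup>3 = 1\<close> has
  \<open>(n + 1) - 2 + J + cnj J\<close> affine points over the field of \<open>n + 1\<close> elements; the definition isolates
  the integer \<open>J + cnj J\<close>.
\<close>
definition jacobi_trace where
  "jacobi_trace = int (card {(x, y). x ^ 3 + y ^ 3 = (1::'a)}) - int n + 1"

text \<open>
  By \<open>cubic_sum_cube\<close> the moments involve only \<open>S\<close>, \<open>S1\<close>, \<open>S2\<close>. The counts of zeros turn into the
  power sums \<open>0\<close>, \<open>6 * (n + 1)\<close> and \<open>3 * (n + 1) * jacobi_trace\<close>, and Newton's identities give the cubic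
  polynomial of which \<open>S\<close>, \<open>S1\<close>, \<open>S2\<close> are the roots. The last relation is the discriminant
  of the quadratic polynomial that remains after splitting off the root \<open>S\<close>.
\<close>
lemma cubic_sum_relations:
  defines "S \<equiv> cubic_sum 1" and "S1 \<equiv> cubic_sum g" and "S2 \<equiv> cubic_sum (g ^ 2)"
  shows "S + S1 + S2 = 0"
    and "S ^ 3 = of_nat (n + 1) * (3 * S + of_int jacobi_trace)"
    and "3 * (4 * of_nat (n + 1) - S ^ 2) = (S1 - S2) ^ 2"
proof -
  obtain a where a: "n = 3 * a" using three_dvd by blast
  have a0: "of_nat a \<noteq> (0::complex)" using a n_pos by simp
  have split: "(\<Sum>b\<in>UNIV. cubic_sum b ^ k) = of_nat (n + 1) ^ k + of_nat a * (S ^ k + S1 ^ k + S2 ^ k)" for k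
    using sum_cubic_classes[OF a, of "\<lambda>b. cubic_sum b ^ k"]
    by (subst sum.remove[of _ 0]) (simp_all add: cubic_sum_0 card_UNIV cubic_sum_cube S_def S1_def S2_def)
  define E where "E = card {(x, y). x ^ 3 + y ^ 3 = (1::'a)}"
  have "of_nat a * (S + S1 + S2) = 0"
    using split[of 1] cubic_sum_moments(1) by (simp add: card_UNIV)
  then show sum: "S + S1 + S2 = 0" using a0 by simp
  have "of_nat a * (S ^ 2 + S1 ^ 2 + S2 ^ 2) = of_nat a * (6 * of_nat (n + 1))"
    using split[of 2] cubic_sum_moments(2)
    by (simp add: card_UNIV card_two_cubes[OF three_dvd] a power2_eq_square algebra_simps)
  then have sq: "S ^ 2 + S1 ^ 2 + S2 ^ 2 = 6 * of_nat (n + 1)"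
    using a0 by (simp only: mult_cancel_left) simp
  have E: "of_nat E = of_int jacobi_trace + of_nat n - (1::complex)" by (simp add: jacobi_trace_def E_def)
  have "of_nat a * (S ^ 3 + S1 ^ 3 + S2 ^ 3) = of_nat a * (3 * of_nat (n + 1) * of_int jacobi_trace)"
    using split[of 3] cubic_sum_moments(3)
    unfolding card_three_cubes[OF three_dvd] E_def[symmetric] of_nat_add of_nat_mult E
    by (simp add: card_UNIV a power3_eq_cube algebra_simps)
  then have cu: "S ^ 3 + S1 ^ 3 + S2 ^ 3 = 3 * of_nat (n + 1) * of_int jacobi_trace"
    using a0 by (simp only: mult_cancel_left) simp
  have S2: "S2 = - S - S1" using sum by (simp add: eq_diff_eq eq_neg_iff_add_eq_0 add_ac)
  have e2: "S ^ 2 + S * S1 + S1 ^ 2 = 3 * of_nat (n + 1)"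
  proof -
    have "2 * (S ^ 2 + S * S1 + S1 ^ 2) = 2 * (3 * of_nat (n + 1))"
      using sq unfolding S2 by (simp add: power2_eq_square algebra_simps)
    then show ?thesis by (simp only: mult_cancel_left) simp
  qed
  have e3: "- (S * S1 * (S + S1)) = of_nat (n + 1) * of_int jacobi_trace"
  proof -
    have "3 * (- (S * S1 * (S + S1))) = 3 * (of_nat (n + 1) * of_int jacobi_trace)"
      using cu unfolding S2 by (simp add: power3_eq_cube algebra_simps)
    then show ?thesis by (simp only: mult_cancel_left) simp
  qed
  have "S ^ 3 = S * (S ^ 2 + S * S1 + S1 ^ 2) + - (S * S1 * (S + S1))"
    by (simp add: power3_eq_cube power2_eq_square algebra_simps)
  then show "S ^ 3 = of_nat (n + 1) * (3 * S + of_int jacobi_trace)"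
    unfolding e2 e3 by (simp add: algebra_simps)
  have "(S1 - S2) ^ 2 = 4 * (S ^ 2 + S * S1 + S1 ^ 2) - 3 * S ^ 2"
    unfolding S2 by (simp add: power2_eq_square algebra_simps)
  then show "3 * (4 * of_nat (n + 1) - S ^ 2) = (S1 - S2) ^ 2"
    unfolding e2 by simp
qed

text \<open>
  Read in the field, the count of \<open>card_fermat_cubic\<close> identifies the integer with \<open>-((2 * a) choose a)\<close>
  for \<open>a = (p ^ e - 1) / 3\<close>.
\<close>
lemma jacobi_trace_not_dvd:
  assumes p: "prime p" "p mod 3 = 1" and card: "n + 1 = p ^ e" and e: "e > 0"
  shows "\<not> int p dvd jacobi_trace"
proof
  assume dvd: "int p dvd jacobi_trace"
  obtain a where a: "n = 3 * a" using three_dvd by blast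
  have char: "CHAR('a) = p" by (rule CHAR_eq[OF p(1) card])
  have "of_int jacobi_trace = of_nat (card {(x, y). x ^ 3 + y ^ 3 = (1::'a)}) - of_nat (n + 1) + (2::'a)"
    unfolding jacobi_trace_def by simp
  also have "\<dots> = - of_nat ((2 * a) choose a)"
    unfolding of_nat_card_UNIV card_fermat_cubic[OF a] by simp
  finally have "of_int jacobi_trace = - (of_nat ((2 * a) choose a) :: 'a)" .
  moreover have "of_int jacobi_trace = (0::'a)"
    using dvd char by (simp add: of_int_eq_0_iff_char_dvd)
  ultimately have "of_nat ((2 * a) choose a) = (0::'a)"
    by (metis neg_equal_0_iff_equal)
  then have "p dvd (2 * a) choose a" by (simp add: of_nat_eq_0_iff_char_dvd char)
  then show False
    using central_binomial_third_not_dvd[OF p, of a e] card a by simp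
qed

end

section \<open>The trace and a character trivial on its kernel\<close>

lemma cis_2pi_div_power:
  assumes "p > (0::nat)" "[i = j] (mod p)"
  shows "cis (2 * pi / p) ^ i = cis (2 * pi / p) ^ j"
proof -
  have one: "cis (2 * pi / p) ^ p = 1"
    using assms(1) by (simp add: DeMoivre)
  have "cis (2 * pi / p) ^ k = cis (2 * pi / p) ^ (k mod p)" for k
  proof -
    have "cis (2 * pi / p) ^ k = cis (2 * pi / p) ^ (p * (k div p) + k mod p)" by simp
    also have "\<dots> = cis (2 * pi / p) ^ (k mod p)"
      by (simp only: power_add power_mult one) simp
    finally show ?thesis .
  qed
  then show ?thesis using assms(2) by (metis cong_def)
qed

locale finite_extension = primitive_element g n
  for g :: "'a::{field,finite}" and n +
  fixes p s q m :: nat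
  assumes p_prime: "prime p" and s_pos: "s \<ge> 1" and q_eq: "q = p ^ s" and m_pos: "m \<ge> 1"
    and card_eq: "n + 1 = q ^ m"
begin

abbreviation Tr :: "'a \<Rightarrow> 'a" where "Tr \<equiv> field_trace q m"

lemma card_p: "n + 1 = p ^ (s * m)"
  using card_eq by (simp only: q_eq power_mult)

lemma char_p: "CHAR('a) = p"
  by (rule CHAR_eq[OF p_prime card_p])

lemma power_p_add: "(x + y :: 'a) ^ (p ^ i) = x ^ (p ^ i) + y ^ (p ^ i)"
  by (rule freshmans_dream') (simp_all add: char_p p_prime)

lemma power_p_sum: "(sum f A :: 'a) ^ (p ^ i) = (\<Sum>x\<in>A. f x ^ (p ^ i))"
  by (rule freshmans_dream_sum') (simp_all add: char_p p_prime)

lemma q_power: "q ^ i = p ^ (s * i)"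
  by (simp add: q_eq power_mult)

lemma q_gt_1: "q > 1"
  using p_prime s_pos prime_gt_1_nat[of p] one_less_power[of p s] by (simp add: q_eq)

lemma power_card: "x ^ (q ^ m) = (x::'a)"
proof (cases "x = 0")
  case True
  then show ?thesis using q_gt_1 by (simp add: power_0_left)
next
  case False
  then show ?thesis unfolding card_eq[symmetric] by (simp add: power_n)
qed

lemma Tr_add: "Tr (x + y) = Tr x + Tr y"
  by (simp add: field_trace_def q_power power_p_add sum.distrib)

lemma Tr_0 [simp]: "Tr 0 = 0"
  using q_gt_1 by (simp add: field_trace_def power_0_left)

lemma Tr_diff: "Tr (x - y) = Tr x - Tr y"
  using Tr_add[of "x - y" y] by simp

lemma power_q_power_fixed: "y ^ q = y \<Longrightarrow> y ^ (q ^ i) = (y::'a)"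
  by (induction i) (simp_all add: power_mult)

lemma Tr_mult:
  assumes "y ^ q = y"
  shows "Tr (y * x) = y * Tr x"
  by (simp add: field_trace_def power_mult_distrib power_q_power_fixed[OF assms] sum_distrib_left)

text \<open>
  Raising to the power \<open>q\<close> shifts the conjugates cyclically, since \<open>x ^ (q ^ m) = x\<close>.
\<close>
lemma Tr_power_q: "Tr (x ^ q) = Tr x"
proof -
  obtain k where m: "m = Suc k" using m_pos by (cases m) auto
  have "Tr (x ^ q) = (\<Sum>i<m. x ^ (q ^ Suc i))"
    by (simp add: field_trace_def flip: power_mult)
  also have "\<dots> = (\<Sum>i<k. x ^ (q ^ Suc i)) + x ^ (q ^ m)"
    by (simp add: m)
  also have "\<dots> = x ^ (q ^ 0) + (\<Sum>i<k. x ^ (q ^ Suc i))"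
    by (simp add: power_card)
  also have "\<dots> = Tr x"
    unfolding field_trace_def m sum.lessThan_Suc_shift by simp
  finally show ?thesis .
qed

lemma Tr_power_q_power: "Tr (x ^ (q ^ i)) = Tr x"
  by (induction i) (simp_all add: power_mult Tr_power_q mult.commute[of q])

lemma Tr_fixed: "Tr x ^ q = Tr x"
proof -
  have "Tr x ^ q = (\<Sum>i<m. (x ^ (q ^ i)) ^ (p ^ s))"
    unfolding field_trace_def q_eq by (rule power_p_sum)
  also have "\<dots> = Tr (x ^ q)"
    by (simp add: field_trace_def q_eq mult.commute flip: power_mult)
  finally show ?thesis by (simp add: Tr_power_q)
qed

text \<open>
  The trace to the prime field. Its values are multiples of \<open>1\<close>, which is what an additive character
  with values in the complex roots of unity can be built from.
\<close>
definition abs_trace :: "'a \<Rightarrow> 'a" where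
  "abs_trace x = (\<Sum>i<s * m. x ^ (p ^ i))"

text \<open>
  Transitivity of the trace, in the form that the absolute trace factors through \<open>Tr\<close>.
\<close>
lemma abs_trace_Tr: "abs_trace x = (\<Sum>i<s. Tr x ^ (p ^ i))"
proof -
  have "(\<Sum>i<s. Tr x ^ (p ^ i)) = (\<Sum>i<s. \<Sum>j<m. x ^ (p ^ (i + s * j)))"
    by (simp add: field_trace_def power_p_sum q_power power_add mult.commute flip: power_mult)
  also have "\<dots> = (\<Sum>j<m. \<Sum>i<s. x ^ (p ^ (i + s * j)))"
    by (rule sum.swap)
  also have "\<dots> = (\<Sum>j<m. sum (\<lambda>k. x ^ (p ^ k)) {j * s..<j * s + s})"
  proof (rule sum.cong)
    fix j
    show "(\<Sum>i<s. x ^ (p ^ (i + s * j))) = sum (\<lambda>k. x ^ (p ^ k)) {j * s..<j * s + s}"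
      using sum.shift_bounds_nat_ivl[of "\<lambda>k. x ^ (p ^ k)" 0 "j * s" s]
      by (simp add: atLeast0LessThan mult.commute add.commute)
  qed simp
  also have "\<dots> = abs_trace x"
    unfolding abs_trace_def sum.nat_group by (simp add: mult.commute)
  finally show ?thesis by simp
qed

lemma abs_trace_add: "abs_trace (x + y) = abs_trace x + abs_trace y"
  by (simp add: abs_trace_def power_p_add sum.distrib)

lemma abs_trace_fixed: "abs_trace x ^ p = abs_trace x"
proof -
  obtain k where k: "s * m = Suc k" using m_pos s_pos by (cases "s * m") auto
  have "abs_trace x ^ p = (\<Sum>i<s * m. x ^ (p ^ Suc i))"
    using power_p_sum[of "\<lambda>i. x ^ (p ^ i)" "{..<s * m}" 1]
    by (simp add: abs_trace_def mult.commute flip: power_mult)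
  also have "\<dots> = (\<Sum>i<k. x ^ (p ^ Suc i)) + x ^ (q ^ m)"
    by (simp add: k q_power)
  also have "\<dots> = x ^ (p ^ 0) + (\<Sum>i<k. x ^ (p ^ Suc i))"
    by (simp add: power_card)
  also have "\<dots> = abs_trace x"
    unfolding abs_trace_def k sum.lessThan_Suc_shift by simp
  finally show ?thesis .
qed

text \<open>
  The power sum of \<open>abs_trace x * x ^ (n - 1)\<close> detects the coefficient of \<open>x\<close> in \<open>abs_trace\<close>: the
  exponent \<open>p ^ i + (n - 1)\<close> is a multiple of \<open>n\<close> for \<open>i = 0\<close> only.
\<close>
lemma abs_trace_nonzero: "\<exists>x. abs_trace x \<noteq> 0"
proof (rule ccontr)
  assume "\<not> ?thesis"
  then have z: "abs_trace x = 0" for x by blast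
  have p1: "p > 1" using p_prime prime_gt_1_nat by blast
  have sm: "s * m > 0" using s_pos m_pos by simp
  have "(\<Sum>x\<in>UNIV. abs_trace x * x ^ (n - 1)) = (\<Sum>i<s * m. \<Sum>x\<in>UNIV. x ^ (p ^ i + (n - 1)))"
    unfolding abs_trace_def sum_distrib_right power_add[symmetric] by (rule sum.swap)
  also have "\<dots> = (\<Sum>i<s * m. if i = 0 then -1 else 0)"
  proof (rule sum.cong)
    fix i assume i: "i \<in> {..<s * m}"
    have "p ^ i < n + 1" unfolding card_p using i p1 by simp
    moreover have "p ^ i \<ge> 1" using p1 by simp
    ultimately have "n dvd p ^ i + (n - 1) \<longleftrightarrow> p ^ i = 1"
    proof -
      assume *: "p ^ i < n + 1" "p ^ i \<ge> 1"
      have "p ^ i + (n - 1) = (p ^ i - 1) + n" using * n_pos by simp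
      then have "n dvd p ^ i + (n - 1) \<longleftrightarrow> n dvd p ^ i - 1" by simp
      also have "\<dots> \<longleftrightarrow> p ^ i - 1 = 0"
      proof -
        have "p ^ i - 1 < n" using * by linarith
        then show ?thesis using nat_dvd_not_less[of "p ^ i - 1" n] by (cases "p ^ i - 1 = 0") auto
      qed
      finally show ?thesis using * by auto
    qed
    also have "p ^ i = 1 \<longleftrightarrow> i = 0" using p1 by (cases i) auto
    finally show "(\<Sum>x\<in>UNIV. x ^ (p ^ i + (n - 1))) = (if i = 0 then -1 else (0::'a))"
      using p1 unfolding sum_powers by simp
  qed simp
  also have "\<dots> = -1" using sm by simp
  finally show False by (simp add: z)
qed

text \<open>
  The character is \<open>\<zeta> ^ abs_trace x\<close> for a primitive complex \<open>p\<close>-th root of unity \<open>\<zeta>\<close>, the exponent being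
  read as a residue modulo \<open>p\<close>. It is trivial on the kernel of \<open>Tr\<close> by \<open>abs_trace_Tr\<close>.
\<close>
lemma exists_trace_character:
  "\<exists>\<psi>. additive_character \<psi> \<and> (\<forall>x::'a. Tr x = 0 \<longrightarrow> \<psi> x = 1)"
proof -
  have p1: "p > 1" using p_prime prime_gt_1_nat by blast
  define \<zeta> where "\<zeta> = cis (2 * pi / p)"
  have zeta: "\<zeta> ^ i = \<zeta> ^ j" if "(of_nat i :: 'a) = of_nat j" for i j
  proof -
    have "[i = j] (mod p)"
      using that by (simp add: of_nat_eq_iff_cong_CHAR char_p)
    then show ?thesis unfolding \<zeta>_def using p1 by (intro cis_2pi_div_power) auto
  qed
  define l where "l x = (SOME j. abs_trace x = of_nat j)" for x
  have l: "of_nat (l x) = abs_trace x" for x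
    unfolding l_def using someI_ex[OF prime_field_elements[OF p_prime char_p abs_trace_fixed]] by simp
  define \<psi> where "\<psi> x = \<zeta> ^ l x" for x
  have psi: "\<psi> x = \<zeta> ^ j" if "abs_trace x = of_nat j" for x j
    unfolding \<psi>_def by (rule zeta) (simp add: l that)
  have "additive_character \<psi>"
  proof
    fix x y :: 'a
    have "abs_trace (x + y) = of_nat (l x + l y)" by (simp add: abs_trace_add l)
    then have "\<psi> (x + y) = \<zeta> ^ (l x + l y)" by (rule psi)
    then show "\<psi> (x + y) = \<psi> x * \<psi> y" by (simp add: \<psi>_def power_add)
  next
    have "abs_trace 0 = of_nat 0" using p1 by (simp add: abs_trace_def power_0_left)
    then show "\<psi> 0 = 1" using psi by fastforce
  next
    obtain x where x: "abs_trace x \<noteq> 0" using abs_trace_nonzero by blast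
    \<comment> \<open>scale within the prime field to reach absolute trace \<open>1\<close>, where the character has value \<open>\<zeta>\<close>\<close>
    let ?y = "inverse (abs_trace x)"
    have "?y ^ p = ?y" using abs_trace_fixed by (simp add: power_inverse)
    then have "?y ^ (p ^ i) = ?y" for i by (induction i) (simp_all add: power_mult)
    then have "abs_trace (?y * x) = ?y * abs_trace x"
      by (simp add: abs_trace_def power_mult_distrib sum_distrib_left)
    then have "abs_trace (?y * x) = of_nat 1" using x by simp
    then have "\<psi> (?y * x) = \<zeta>" using psi by fastforce
    moreover have "\<zeta> \<noteq> 1"
    proof
      assume "\<zeta> = 1"
      then have "cos (2 * pi / p) = 1" by (simp add: \<zeta>_def complex_eq_iff)
      then obtain k :: int where "2 * pi / p = of_int k * 2 * pi" using cos_one_2pi_int by auto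
      then have "(2 * pi) * (1 / real p) = (2 * pi) * of_int k" by simp
      then have "1 / real p = of_int k" by (simp only: mult_cancel_left) simp
      then have "real_of_int (k * int p) = 1" using p1 by (simp add: field_simps)
      then have "k * int p = 1" by (simp only: of_int_eq_1_iff)
      then show False using p1 by (simp add: zmult_eq_1_iff)
    qed
    ultimately show "\<exists>x. \<psi> x \<noteq> 1" by metis
  qed
  moreover have "\<psi> x = 1" if "Tr x = 0" for x
  proof -
    have "abs_trace x = of_nat 0"
      unfolding abs_trace_Tr that using p1 by (simp add: power_0_left)
    then show ?thesis using psi by fastforce
  qed
  ultimately show ?thesis by blast
qed

end

section \<open>The value of the cubic sum for a trace character\<close>

locale cubic_trace = finite_extension g n p s q m + additive_character \<psi>
  for g :: "'a::{field,finite}" and n p s q m :: nat and \<psi> :: "'a \<Rightarrow> complex" +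
  fixes t Q :: nat
  assumes p_mod_3: "p mod 3 = 1" and m_eq: "m = 3 * t"
    and psi_Tr: "Tr x = 0 \<Longrightarrow> \<psi> x = 1"
    and Q_eq: "Q * (q - 1) = n" and three_dvd_Q: "3 dvd Q"

sublocale cubic_trace \<subseteq> cubic_periods g n \<psi>
  by standard (metis Q_eq three_dvd_Q dvd_mult2)

context cubic_trace
begin

lemma n_factor: "n = (q - 1) * Q"
  by (simp only: Q_eq[symmetric] mult.commute)

text \<open>The subfield with \<open>q\<close> elements, in which \<open>Tr\<close> takes its values.\<close>
definition L :: "'a set" where "L = {y. y ^ q = y}"

lemma L_eq: "L = insert 0 {y. y ^ (q - 1) = 1}"
proof -
  have q: "q = Suc (q - 1)" using q_gt_1 by simp
  have "y ^ q = y \<longleftrightarrow> y = 0 \<or> y ^ (q - 1) = 1" for y :: 'a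
    by (subst q) (auto simp del: Suc_pred Suc_diff_1)
  then show ?thesis by (auto simp: L_def)
qed

lemma card_L: "card L = q"
proof -
  have "0 ^ (q - 1) \<noteq> (1::'a)" using q_gt_1 by (simp add: power_0_left)
  moreover have "card {y::'a. y ^ (q - 1) = 1} = q - 1"
    by (rule card_roots_of_unity(1)[OF n_factor])
  ultimately show ?thesis unfolding L_eq using q_gt_1 by simp
qed

lemma L_0: "0 \<in> L"
  by (simp add: L_eq)

lemma power_Q_L: "g ^ (Q * j) \<in> L"
proof -
  from card_roots_of_unity(2)[OF n_factor] show ?thesis by (auto simp: L_eq)
qed

text \<open>
  The non-zero elements of the subfield are the powers of \<open>g ^ Q\<close>, and \<open>3\<close> divides \<open>Q\<close>.
\<close>
lemma L_cube:
  assumes "y \<in> L" "y \<noteq> 0"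
  obtains u where "u \<noteq> 0" "y = u ^ 3"
proof -
  from card_roots_of_unity(2)[OF n_factor] assms obtain j where j: "y = g ^ (Q * j)"
    by (auto simp: L_eq)
  obtain k where "Q = 3 * k" using three_dvd_Q by blast
  then have "y = (g ^ (k * j)) ^ 3"
    unfolding j by (simp add: mult.commute mult.assoc flip: power_mult)
  then show thesis using that by (metis g_nonzero power_not_zero)
qed

lemma Tr_L: "Tr x \<in> L"
  by (simp add: L_def Tr_fixed)

lemma Tr_scale: "y \<in> L \<Longrightarrow> Tr (y * x) = y * Tr x"
  by (rule Tr_mult) (simp add: L_def)

text \<open>
  By linearity of \<open>Tr\<close>, the map \<open>y \<mapsto> \<psi> (y * z)\<close> is an additive character of the subfield. It is
  trivial if \<open>Tr z = 0\<close>; otherwise \<open>Tr (y * z)\<close> takes every value of \<open>Tr\<close>, so that it is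
  non-trivial and sums to zero.
\<close>
lemma sum_L_psi: "(\<Sum>y\<in>L. \<psi> (y * z)) = (if Tr z = 0 then of_nat q else 0)"
proof (cases "Tr z = 0")
  case True
  then have "\<psi> (y * z) = 1" if "y \<in> L" for y
    using that by (simp add: psi_Tr Tr_scale)
  then show ?thesis using True by (simp add: card_L)
next
  case False
  obtain x where x: "\<psi> x \<noteq> 1" using psi_nontrivial by blast
  \<comment> \<open>chosen so that \<open>y0 * z\<close> and \<open>x\<close> have the same trace, hence the same character value\<close>
  define y0 where "y0 = Tr x / Tr z"
  have y0: "y0 \<in> L" by (simp add: y0_def L_def power_divide Tr_fixed)
  have "Tr (y0 * z - x) = 0"
    using False by (simp add: Tr_diff Tr_scale[OF y0]) (simp add: y0_def)
  then have "\<psi> (y0 * z - x) = 1" by (rule psi_Tr)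
  then have psi0: "\<psi> (y0 * z) = \<psi> x"
    using psi_add[of "y0 * z - x" x] by simp
  have power_q_add: "(y + y') ^ q = y ^ q + y' ^ q" for y y' :: 'a
    unfolding q_eq by (rule power_p_add)
  have L_add: "y + y' \<in> L" if "y \<in> L" "y' \<in> L" for y y'
    using that by (simp add: L_def power_q_add)
  have L_diff: "y - y' \<in> L" if "y \<in> L" "y' \<in> L" for y y'
    using that power_q_add[of "y - y'" y'] by (simp add: L_def eq_diff_eq)
  have "(\<Sum>y\<in>L. \<psi> (y * z)) = (\<Sum>y\<in>L. \<psi> (y * z + y0 * z))"
    by (rule sum.reindex_bij_witness[of _ "\<lambda>y. y + y0" "\<lambda>y. y - y0"])
       (auto simp: algebra_simps y0 intro: L_add L_diff)
  also have "\<dots> = (\<Sum>y\<in>L. \<psi> (y * z)) * \<psi> x"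
    by (simp add: psi_add psi0 sum_distrib_right)
  finally have "(\<Sum>y\<in>L. \<psi> (y * z)) * (\<psi> x - 1) = 0" by (simp add: algebra_simps)
  then show ?thesis using x False by simp
qed

lemma card_Tr_0:
  fixes h :: "'t::finite \<Rightarrow> 'a"
  shows "of_nat q * of_nat (card {x. Tr (h x) = 0}) = (\<Sum>y\<in>L. \<Sum>x\<in>UNIV. \<psi> (y * h x))"
proof -
  have "(\<Sum>y\<in>L. \<Sum>x\<in>UNIV. \<psi> (y * h x)) = (\<Sum>x\<in>UNIV. \<Sum>y\<in>L. \<psi> (y * h x))"
    by (rule sum.swap)
  also have "\<dots> = (\<Sum>x | Tr (h x) = 0. of_nat q)"
    by (simp add: sum_L_psi sum.If_cases)
  finally show ?thesis by (simp add: mult.commute)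
qed

lemma card_kernel_Tr: "q * card {x. Tr x = 0} = n + 1"
proof -
  have "of_nat q * of_nat (card {x. Tr x = 0}) = (\<Sum>y\<in>L. \<Sum>x\<in>UNIV. \<psi> (x * y))"
    unfolding card_Tr_0 by (simp add: mult.commute)
  also have "\<dots> = (\<Sum>y\<in>L. if y = 0 then of_nat (n + 1) else 0)"
    by (simp only: sum_psi_mult card_UNIV)
  also have "\<dots> = of_nat (n + 1)" using L_0 by simp
  finally show ?thesis by (simp only: of_nat_mult[symmetric] of_nat_eq_iff)
qed

definition N0 where "N0 b = card {x. Tr (b * x ^ 3) = 0}"
definition N1 where "N1 b = card {x. Tr (b * x ^ 3) = 1}"

text \<open>
  Each of the \<open>q - 1\<close> non-zero elements \<open>y\<close> of the subfield is a cube, so \<open>cubic_sum (b * y)\<close> does not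
  depend on it.
\<close>
lemma N0_cubic_sum: "of_nat q * of_nat (N0 b) = of_nat (n + 1) + of_nat (q - 1) * cubic_sum b"
proof -
  have "of_nat q * of_nat (N0 b) = (\<Sum>y\<in>L. cubic_sum (b * y))"
    unfolding N0_def card_Tr_0 cubic_sum_def by (simp add: mult_ac)
  also have "\<dots> = cubic_sum 0 + (\<Sum>y\<in>L-{0}. cubic_sum (b * y))"
    using L_0 by (subst sum.remove[of _ 0]) auto
  also have "(\<Sum>y\<in>L-{0}. cubic_sum (b * y)) = (\<Sum>y\<in>L-{0}. cubic_sum b)"
    by (rule sum.cong) (auto elim!: L_cube simp: cubic_sum_cube)
  finally show ?thesis using L_0 by (simp add: cubic_sum_0 card_UNIV card_L)
qed

text \<open>
  All non-zero values \<open>j\<close> of \<open>Tr (b * x ^ 3)\<close> are equally frequent: writing \<open>j = u\<^sup>3\<close>, the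
  substitution \<open>x \<mapsto> u x\<close> carries the value \<open>1\<close> to \<open>j\<close>.
\<close>
lemma N0_N1: "N0 b + (q - 1) * N1 b = n + 1"
proof -
  let ?F = "\<lambda>j. {x. Tr (b * x ^ 3) = j}"
  have fib: "card (?F j) = N1 b" if j: "j \<in> L - {0}" for j
  proof -
    obtain u where u: "u \<noteq> 0" "j = u ^ 3" using j L_cube by blast
    have eq: "Tr (b * (u * x) ^ 3) = j * Tr (b * x ^ 3)" for x
      using Tr_scale[of j "b * x ^ 3"] j by (simp add: u(2) power_mult_distrib mult_ac)
    have "bij_betw (\<lambda>x. u * x) (?F 1) (?F j)"
    proof (rule bij_betw_byWitness[where f' = "\<lambda>x. x / u"])
      show "(\<lambda>x. u * x) ` ?F 1 \<subseteq> ?F j" using eq by auto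
      have "Tr (b * (x / u) ^ 3) = 1" if "Tr (b * x ^ 3) = j" for x
        using eq[of "x / u"] that u j by simp
      then show "(\<lambda>x. x / u) ` ?F j \<subseteq> ?F 1" by auto
    qed (use u in auto)
    then show ?thesis unfolding N1_def by (metis bij_betw_same_card)
  qed
  have "UNIV = (\<Union>j\<in>L. ?F j)" using Tr_L by auto
  then have "card (UNIV :: 'a set) = card (\<Union>j\<in>L. ?F j)" by (rule arg_cong)
  also have "\<dots> = (\<Sum>j\<in>L. card (?F j))"
    by (rule card_UN_disjoint) (simp, simp, blast)
  also have "\<dots> = N0 b + (\<Sum>j\<in>L-{0}. card (?F j))"
    using L_0 by (subst sum.remove[of _ 0]) (auto simp: N0_def)
  also have "(\<Sum>j\<in>L-{0}. card (?F j)) = (\<Sum>j\<in>L-{0}. N1 b)"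
    by (rule sum.cong) (simp_all only: fib)
  finally show ?thesis using L_0 by (simp add: card_UNIV card_L)
qed

lemma cubic_sum_int: "cubic_sum b = of_int (int (N0 b) - int (N1 b))"
proof -
  have q: "of_nat q = of_nat (q - 1) + (1::complex)"
    using q_gt_1 by (simp add: of_nat_diff)
  have n: "of_nat (n + 1) = of_nat (N0 b) + of_nat (q - 1) * (of_nat (N1 b) :: complex)"
    unfolding N0_N1[of b, symmetric] by simp
  have "of_nat (q - 1) * cubic_sum b = of_nat q * of_nat (N0 b) - of_nat (n + 1)"
    by (simp only: N0_cubic_sum add_diff_cancel_left')
  also have "\<dots> = of_nat (q - 1) * (of_nat (N0 b) - of_nat (N1 b))"
    unfolding q n by (simp add: algebra_simps)
  finally have "of_nat (q - 1) * cubic_sum b = of_nat (q - 1) * (of_nat (N0 b) - of_nat (N1 b))" .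
  moreover have "of_nat (q - 1) \<noteq> (0::complex)" using q_gt_1 by simp
  ultimately show ?thesis by (simp only: mult_cancel_left) simp
qed

lemma N0_cubes: "N0 b = 1 + card {x. x \<noteq> 0 \<and> Tr (b * x ^ 3) = 0}"
proof -
  have "{x. Tr (b * x ^ 3) = 0} = insert 0 {x. x \<noteq> 0 \<and> Tr (b * x ^ 3) = 0}" by auto
  then show ?thesis unfolding N0_def by simp
qed

lemma N1_cubes: "N1 b = card {x. x \<noteq> 0 \<and> Tr (b * x ^ 3) = 1}"
proof -
  have "{x. Tr (b * x ^ 3) = 1} = {x. x \<noteq> 0 \<and> Tr (b * x ^ 3) = 1}" by auto
  then show ?thesis unfolding N1_def by simp
qed

definition r where "r = q ^ t"

lemma n_r: "n + 1 = r ^ 3"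
  by (simp only: card_eq m_eq r_def power_mult[symmetric] mult.commute)

lemma t_pos: "t \<ge> 1"
  using m_pos m_eq by simp

lemma r_p: "r = p ^ (s * t)"
  by (simp add: r_def q_power)

lemma r_mod_3: "r mod 3 = 1"
  using power_mod[of p 3 "s * t"] by (simp add: r_p p_mod_3)

text \<open>
  Cubing contributes one factor \<open>3\<close>. The other one comes from the action of \<open>u \<mapsto> u ^ r\<close>, which has order
  dividing three because the field has \<open>r\<^sup>3\<close> elements, preserves the trace, and preserves the classes modulo
  cubes because \<open>r \<equiv> 1 (mod 3)\<close>. Its non-zero fixed points are the elements of the subfield of size
  \<open>r\<close>. These are cubes, since the index \<open>r\<^sup>2 + r + 1\<close> of its multiplicative group is divisible by
  \<open>3\<close>, so the action on a class of non-cubes is free.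
\<close>
lemma noncube_class_dvd_9:
  assumes b: "b \<noteq> 0" "\<nexists>x. b = x ^ 3"
  shows "9 dvd card {x. x \<noteq> 0 \<and> Tr (b * x ^ 3) = j}"
proof -
  let ?A = "{u. (\<exists>x. x \<noteq> 0 \<and> u = b * x ^ 3) \<and> Tr u = j}"
  have r1: "r > 1" using r_p p_prime t_pos s_pos prime_gt_1_nat[of p] one_less_power[of p "s * t"] by simp
  obtain e where e: "r = 3 * e + 1" using r_mod_3 by (metis mult_div_mod_eq)
  have nr: "n = (r - 1) * (r ^ 2 + r + 1)"
  proof -
    have "r ^ 3 = (r - 1) * (r ^ 2 + r + 1) + 1"
      unfolding e by (simp add: power2_eq_square power3_eq_cube algebra_simps)
    then show ?thesis using n_r by simp
  qed
  have "r ^ 2 + r + 1 = 3 * (3 * e ^ 2 + 3 * e + 1)"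
    unfolding e by (simp add: power2_eq_square algebra_simps)
  then have "3 dvd r ^ 2 + r + 1" by (rule dvdI)
  have "3 dvd card ?A"
  proof (rule card_free_order_3[where f = "\<lambda>u. u ^ r"])
    fix u assume u: "u \<in> ?A"
    then obtain x where x: "x \<noteq> 0" "u = b * x ^ 3" "Tr u = j" by blast
    have "b ^ r = b * (b ^ e) ^ 3"
      unfolding e by (simp add: power_add mult.commute flip: power_mult)
    moreover have "(x ^ 3) ^ r = (x ^ r) ^ 3"
      by (simp only: power_mult[symmetric] mult.commute)
    ultimately have "u ^ r = b * (b ^ e * x ^ r) ^ 3"
      unfolding x(2) power_mult_distrib by simp
    moreover have "b ^ e * x ^ r \<noteq> 0" using b x by simp
    moreover have "Tr (u ^ r) = j" unfolding r_def Tr_power_q_power by (rule x(3))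
    ultimately show "u ^ r \<in> ?A" by blast
    have "((u ^ r) ^ r) ^ r = u ^ (r ^ 3)"
      by (simp add: power3_eq_cube mult_ac flip: power_mult)
    also have "\<dots> = u" unfolding n_r[symmetric] card_eq by (rule power_card)
    finally show "((u ^ r) ^ r) ^ r = u" .
    show "u ^ r \<noteq> u"
    proof
      assume "u ^ r = u"
      moreover have "u ^ r = u ^ (r - 1) * u" using r1 by (metis power_minus_mult gr_implies_not0 not_gr_zero)
      moreover have "u \<noteq> 0" using b x by simp
      ultimately have "u ^ (r - 1) = 1" by simp
      with card_roots_of_unity(2)[OF nr] obtain i where "u = g ^ ((r ^ 2 + r + 1) * i)" by blast
      moreover have "3 dvd (r ^ 2 + r + 1) * i" using \<open>3 dvd r ^ 2 + r + 1\<close> by (rule dvd_mult2)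
      ultimately obtain y where y: "u = y ^ 3"
        using is_power_iff[OF three_dvd, of "(r ^ 2 + r + 1) * i"] by metis
      have "b = (y / x) ^ 3" using x y by (simp add: power_divide)
      with b show False by blast
    qed
  qed simp
  then show ?thesis
    unfolding card_cube_multiples[OF three_dvd b(1), of "\<lambda>u. Tr u = j"] by presburger
qed

text \<open>
  The relations between the three cubic sums hold in the complex numbers but concern integers, so
  they transfer to the integers, where the arithmetic of \<open>cubic_periods_integral\<close> applies.
\<close>
lemma cubic_sum_value:
  obtains c d :: int where "cubic_sum 1 = of_int (int r * c)" "4 * int r = c\<^sup>2 + 27 * d\<^sup>2"
    "\<not> int p dvd c" "c mod 3 = 1"
proof -
  define S where "S b = int (N0 b) - int (N1 b)" for b
  have S: "cubic_sum b = of_int (S b)" for b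
    by (simp add: S_def cubic_sum_int)
  have mod9: "S (g ^ i) mod 9 = 1" if "\<not> 3 dvd i" for i
  proof -
    have "\<nexists>x. g ^ i = x ^ 3" using is_power_iff[OF three_dvd] that by blast
    then have "9 dvd card {x. x \<noteq> 0 \<and> Tr (g ^ i * x ^ 3) = j}" for j
      by (intro noncube_class_dvd_9) auto
    then have "9 dvd N0 (g ^ i) - 1" "9 dvd N1 (g ^ i)" "N0 (g ^ i) \<ge> 1"
      by (simp_all add: N0_cubes N1_cubes)
    then show ?thesis unfolding S_def by presburger
  qed
  note rel = cubic_sum_relations[unfolded S n_r]
  have "p \<noteq> 3" using p_mod_3 by auto
  moreover have "s * t \<ge> 1" using s_pos t_pos by simp
  moreover have "S 1 ^ 3 = int r ^ 3 * (3 * S 1 + jacobi_trace)"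
  proof -
    have "complex_of_int (S 1 ^ 3) = of_int (int r ^ 3 * (3 * S 1 + jacobi_trace))" using rel(2) by simp
    then show ?thesis by (simp only: of_int_eq_iff)
  qed
  moreover have "3 * (4 * int r ^ 3 - (S 1)\<^sup>2) = (S g - S (g ^ 2))\<^sup>2"
  proof -
    have "complex_of_int (3 * (4 * int r ^ 3 - (S 1)\<^sup>2)) = of_int ((S g - S (g ^ 2))\<^sup>2)" using rel(3) by simp
    then show ?thesis by (simp only: of_int_eq_iff)
  qed
  moreover have "S 1 + S g + S (g ^ 2) = 0"
  proof -
    have "complex_of_int (S 1 + S g + S (g ^ 2)) = of_int 0" using rel(1) by simp
    then show ?thesis by (simp only: of_int_eq_iff)
  qed
  moreover have "S g mod 9 = 1" "S (g ^ 2) mod 9 = 1"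
    using mod9[of 1] mod9[of 2] by simp_all
  moreover have "\<not> int p dvd jacobi_trace"
    using jacobi_trace_not_dvd[OF p_prime p_mod_3 card_p] s_pos m_pos by simp
  ultimately obtain c d where "S 1 = int r * c" "4 * int r = c\<^sup>2 + 27 * d\<^sup>2" "\<not> int p dvd c" "c mod 3 = 1"
    using cubic_periods_integral[OF p_prime _ r_p _ r_mod_3] by metis
  then show ?thesis using that S by metis
qed

text \<open>
  The kernel of \<open>Tr\<close> has \<open>q ^ (m - 1)\<close> elements; removing zero and the \<open>(N0 1 - 1) / 3\<close> non-zero cubes
  leaves the non-cubes.
\<close>
lemma card_noncubes:
  fixes c d :: int
  assumes c: "4 * int r = c\<^sup>2 + 27 * d\<^sup>2" "\<not> int p dvd c" "c mod 3 = 1"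
  shows "3 * int q * int (card {u. u \<noteq> 0 \<and> (\<nexists>x. u = x ^ 3) \<and> Tr u = 0})
    = (int q - 1) * (2 * (int Q - 1) - int r * c)"
proof -
  obtain c' d' where c': "cubic_sum 1 = of_int (int r * c')" "4 * int r = c'\<^sup>2 + 27 * d'\<^sup>2"
    "\<not> int p dvd c'" "c' mod 3 = 1" by (rule cubic_sum_value)
  have "c' = c"
  proof (rule representation_unique)
    show "prime p" by (rule p_prime)
    show "p \<noteq> 2" using p_mod_3 by auto
    show "s * t \<ge> 1" using s_pos t_pos by simp
    show "4 * int p ^ (s * t) = c'\<^sup>2 + 27 * d'\<^sup>2" using c'(2) by (simp add: r_p)
    show "4 * int p ^ (s * t) = c\<^sup>2 + 27 * d\<^sup>2" using c(1) by (simp add: r_p)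
  qed (use c c' in auto)
  have cube: "(\<exists>x. x \<noteq> 0 \<and> u = 1 * x ^ 3) \<and> Tr u = 0 \<longleftrightarrow> u \<noteq> 0 \<and> (\<exists>x. u = x ^ 3) \<and> Tr u = 0" for u
    by auto
  define M where "M = card {u. u \<noteq> 0 \<and> (\<exists>x. u = x ^ 3) \<and> Tr u = 0}"
  define X where "X = card {u. u \<noteq> 0 \<and> (\<nexists>x. u = x ^ 3) \<and> Tr u = 0}"
  have "N0 1 = 1 + 3 * M"
    unfolding N0_cubes M_def
    using card_cube_multiples[OF three_dvd, of 1 "\<lambda>u. Tr u = 0"] unfolding cube by simp
  moreover have "complex_of_int (int q * int (N0 1)) = of_int (int (n + 1) + int (q - 1) * (int r * c))"
    using N0_cubic_sum[of 1] c'(1) \<open>c' = c\<close> by simp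
  then have "int q * int (N0 1) = int (n + 1) + int (q - 1) * (int r * c)"
    by (simp only: of_int_eq_iff)
  ultimately have M: "int q * (1 + 3 * int M) = int (n + 1) + int (q - 1) * (int r * c)"
    by simp
  have "{x. Tr x = 0} = insert 0 ({u. u \<noteq> 0 \<and> (\<exists>x. u = x ^ 3) \<and> Tr u = 0}
      \<union> {u. u \<noteq> 0 \<and> (\<nexists>x. u = x ^ 3) \<and> Tr u = 0})"
    by (auto simp del: not_ex)
  moreover have "card \<dots> = 1 + (M + X)"
  proof -
    have "card ({u. u \<noteq> 0 \<and> (\<exists>x. u = x ^ 3) \<and> Tr u = 0} \<union> {u. u \<noteq> 0 \<and> (\<nexists>x. u = x ^ 3) \<and> Tr u = 0})
        = M + X"
      unfolding M_def X_def by (rule card_Un_disjoint) (simp, simp, blast)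
    then show ?thesis by (subst card_insert_disjoint) simp_all
  qed
  ultimately have "q * (1 + (M + X)) = n + 1"
    using card_kernel_Tr by simp
  then have X: "int q * (1 + (int M + int X)) = int (n + 1)"
    by (metis of_nat_1 of_nat_add of_nat_mult)
  have q: "int (q - 1) = int q - 1" using q_gt_1 by simp
  have n: "int (n + 1) = int Q * (int q - 1) + 1"
    unfolding Q_eq[symmetric] by (simp only: of_nat_mult of_nat_add q of_nat_1)
  have "3 * int q * int X = 3 * (int q * (1 + (int M + int X))) - int q * (1 + 3 * int M) - 2 * int q"
    by (simp add: algebra_simps)
  also have "\<dots> = (int q - 1) * (2 * (int Q - 1) - int r * c)"
    unfolding M X n q by (simp add: algebra_simps)
  finally show ?thesis by (simp add: X_def)
qed

end

section \<open>From free elements to non-cubes\<close>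

context cubic_trace
begin

lemma Tr_power_g_mod_Q: "Tr (g ^ (k mod Q)) = 0 \<longleftrightarrow> Tr (g ^ k) = 0"
proof -
  have "g ^ k = g ^ (Q * (k div Q)) * g ^ (k mod Q)"
    by (simp flip: power_add)
  then have "Tr (g ^ k) = g ^ (Q * (k div Q)) * Tr (g ^ (k mod Q))"
    using Tr_scale[OF power_Q_L] by simp
  then show ?thesis by simp
qed

lemma card_index:
  assumes "\<And>u. P u \<Longrightarrow> u \<noteq> 0"
  shows "card {u. P u} = card {k. k < n \<and> P (g ^ k)}"
proof -
  have "bij_betw (\<lambda>k. g ^ k) {k. k < n \<and> P (g ^ k)} {u. P u}"
  proof (rule bij_betw_subset[OF bij_powers])
    show "(\<lambda>k. g ^ k) ` {k. k < n \<and> P (g ^ k)} = {u. P u}"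
    proof (intro equalityI subsetI)
      fix u assume u: "u \<in> {u. P u}"
      then have "u \<in> (\<lambda>k. g ^ k) ` {..<n}"
        using assms bij_powers by (auto simp: bij_betw_def)
      with u show "u \<in> (\<lambda>k. g ^ k) ` {k. k < n \<and> P (g ^ k)}" by auto
    qed auto
  qed auto
  from bij_betw_same_card[OF this] show ?thesis by simp
qed

text \<open>
  In terms of exponents \<open>k < n\<close>, both sets are cut out by the same condition on \<open>k mod Q\<close>, namely that
  \<open>3\<close> does not divide it and that the trace vanishes; being free adds coprimality to \<open>K\<close>, to which
  \<open>card_periodic_coprime\<close> applies.
\<close>
lemma Z_noncubes:
  assumes N: "N dvd n" "N = 3 ^ v * K" "\<not> 3 dvd K" "v > 0" and gcd: "gcd N Q = 3 ^ l"
  shows "Z q m N (0::'a) * K = card {u. u \<noteq> 0 \<and> (\<nexists>x. u = x ^ 3) \<and> Tr u = 0} * totient K"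
proof -
  define A where "A i \<longleftrightarrow> \<not> 3 dvd i \<and> Tr (g ^ i) = 0" for i
  have A: "A (k mod Q) \<longleftrightarrow> A k" for k
    using three_dvd_Q by (simp add: A_def Tr_power_g_mod_Q dvd_mod_iff)
  have Q0: "Q > 0" using Q_eq n_pos by (auto intro: Nat.gr0I)
  have K0: "K > 0" using N by (auto intro: Nat.gr0I)
  have "coprime K Q"
  proof -
    have "gcd K Q dvd gcd N Q" using N(2) by (intro gcd_mono) simp_all
    then have dvd: "gcd K Q dvd 3 ^ l" by (simp only: gcd)
    have "coprime 3 K" using N(3) by (intro prime_imp_coprime) simp_all
    then have "coprime (3 ^ l) (gcd K Q)" by (metis coprime_divisors coprime_power_left_iff dvd_refl gcd_dvd1)
    with dvd show ?thesis
      by (metis coprime_absorb_right coprime_iff_gcd_eq_1 is_unit_gcd nat_dvd_1_iff_1 coprime_commute)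
  qed
  then have QK: "coprime Q K" by (simp add: coprime_commute)
  have "K dvd Q * (q - 1)" unfolding Q_eq using N(1,2) by (metis dvd_mult_right)
  then have Kq: "K dvd q - 1" using \<open>coprime K Q\<close> by (simp add: coprime_dvd_mult_right_iff)
  have free: "N_free N (g ^ k) \<longleftrightarrow> \<not> 3 dvd k \<and> coprime k K" for k
  proof -
    have "coprime k 3 \<longleftrightarrow> \<not> 3 dvd k"
      using prime_imp_coprime[of 3 k] by (auto simp: coprime_commute dest: coprime_common_divisor[of k 3 3])
    then show ?thesis
      unfolding N_free_power_iff[OF N(1)] unfolding N(2) using N(4) by simp
  qed
  have "Z q m N (0::'a) = card {k. k < n \<and> N_free N (g ^ k) \<and> Tr (g ^ k) = 0}"
    unfolding Z_def by (rule card_index) (simp add: N_free_def)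
  also have "{k. k < n \<and> N_free N (g ^ k) \<and> Tr (g ^ k) = 0}
      = {k. k < Q * (q - 1) \<and> A (k mod Q) \<and> coprime k K}"
    unfolding A Q_eq by (auto simp: free A_def)
  finally have "Z q m N (0::'a) * K = card {k. k < Q * (q - 1) \<and> A (k mod Q)} * totient K"
    using card_periodic_coprime[OF Q0 K0 Kq QK] by simp
  also have "{k. k < Q * (q - 1) \<and> A (k mod Q)}
      = {k. k < n \<and> g ^ k \<noteq> 0 \<and> (\<nexists>x. g ^ k = x ^ 3) \<and> Tr (g ^ k) = 0}"
    unfolding A Q_eq is_power_iff[OF three_dvd] by (simp add: A_def)
  also have "card \<dots> = card {u. u \<noteq> 0 \<and> (\<nexists>x. u = x ^ 3) \<and> Tr u = 0}"
    by (rule card_index[symmetric]) simp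
  finally show ?thesis .
qed

end

section \<open>The number of free elements of trace zero\<close>

theorem corollary1p7:
  fixes p s q m Q N n K :: nat and c d :: int
  assumes "prime p" and "[p = 1] (mod 3)"
    and "s \<ge> 1" and "q = p ^ s" and "m \<ge> 1"
    and "card (UNIV :: 'a::{field,finite} set) = q ^ m"
    and "Q = (q ^ m - 1) div (q - 1)"
    and "N dvd q ^ m - 1"
    and "n \<ge> 1" and "gcd N Q = 3 ^ n"
    and "K = Max {k. k dvd N \<and> \<not> 3 dvd k}"
    and "[c = 1] (mod 3)" and "\<not> int p dvd c"
    and "4 * real q powr (real m / 3) = of_int (c\<^sup>2 + 27 * d\<^sup>2)"
  shows "real (Z q m N (0::'a)) =
    ((real q - 1) * real (totient K)) / (real q * real K) *
    ((2 * real Q - 2 - of_int c * real q powr (real m / 3)) / 3)"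
proof -
  have p3: "p mod 3 = 1" and c3: "c mod 3 = 1"
    using assms(2,12) by (simp_all add: cong_def)
  have q1: "q > 1"
    using assms(1,3,4) prime_gt_1_nat[of p] one_less_power[of p s] by simp
  have q3: "q mod 3 = 1" using power_mod[of p 3 s] by (simp add: assms(4) p3)
  define M where "M = card (UNIV :: 'a set) - 1"
  obtain g :: 'a where g: "primitive_element g M"
    unfolding M_def using primitive_element_exists by blast
  then interpret primitive_element g M .
  have M: "M = q ^ m - 1" by (simp add: M_def assms(6))
  have "M = (\<Sum>i<m. q ^ i) * (q - 1)"
    using repunit_eq[of q m] q1 unfolding M by linarith
  moreover from this have Q: "Q = (\<Sum>i<m. q ^ i)"
    unfolding assms(7) M[symmetric] using q1 by simp
  ultimately have Qq: "Q * (q - 1) = M" by simp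
  have "3 dvd gcd N Q" using assms(9,10) by simp
  then have three: "3 dvd N" "3 dvd Q" by simp_all
  have "Q mod 3 = m mod 3"
    unfolding Q by (rule repunit_mod_3[OF q3])
  with three(2) have "3 dvd m" by presburger
  then obtain t where t: "m = 3 * t" by blast
  interpret finite_extension g M p s q m
    by standard (use assms(1,3-6) card_UNIV in auto)
  obtain \<psi> where psi: "additive_character \<psi>" "\<And>x::'a. Tr x = 0 \<Longrightarrow> \<psi> x = 1"
    using exists_trace_character by blast
  interpret additive_character \<psi> by (rule psi(1))
  interpret cubic_trace g M p s q m \<psi> t Q
    by standard (use p3 t psi(2) Qq three(2) in auto)
  have "real q powr (real m / 3) = real q ^ t"
    using q1 by (simp add: t powr_realpow)
  then have r: "real q powr (real m / 3) = real r" by (simp add: r_def)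
  have "real_of_int (4 * int r) = of_int (c\<^sup>2 + 27 * d\<^sup>2)" using assms(14) r by simp
  then have rep: "4 * int r = c\<^sup>2 + 27 * d\<^sup>2" by (simp only: of_int_eq_iff)
  define X where "X = card {u::'a. u \<noteq> 0 \<and> (\<nexists>x. u = x ^ 3) \<and> Tr u = 0}"
  have "3 * int q * int X = (int q - 1) * (2 * (int Q - 1) - int r * c)"
    unfolding X_def by (rule card_noncubes[OF rep assms(13) c3])
  then have "real_of_int (3 * int q * int X) = of_int ((int q - 1) * (2 * (int Q - 1) - int r * c))"
    by (simp only: of_int_eq_iff)
  then have X: "3 * real q * real X = (real q - 1) * (2 * real Q - 2 - of_int c * real r)"
    by (simp add: algebra_simps)
  have "N dvd M" using assms(8) M by simp
  then have "N > 0" using n_pos by (auto intro: Nat.gr0I)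
  then obtain v where v: "N = 3 ^ v * K" "\<not> 3 dvd K"
    using max_divisor_not_dvd_3 assms(11) by metis
  have "v > 0" using v three(1) by (auto intro: Nat.gr0I)
  have "Z q m N (0::'a) * K = X * totient K"
    unfolding X_def by (rule Z_noncubes[OF \<open>N dvd M\<close> v \<open>v > 0\<close> assms(10)])
  then have "real (Z q m N (0::'a)) * real K = real X * real (totient K)"
    by (metis of_nat_mult)
  moreover have "real K > 0" using v(2) by (auto intro: Nat.gr0I)
  ultimately have "real (Z q m N (0::'a)) = real X * real (totient K) / real K"
    by (simp add: field_simps)
  also have "real X = (real q - 1) * (2 * real Q - 2 - of_int c * real r) / (3 * real q)"
    using X q1 by (simp add: field_simps)
  finally show ?thesis unfolding r by (simp add: mult_ac)
qed

end
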